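(* Put $f_{2i}=a_i$ for $i=1,\ldots,n$ and $f_{2i+1}=b_i-a_i$ for $i=0,\ldots,n$, where $a_0:=0$. Then $f_{2n+1}=0$, and $\{f_i: 1\le i\le 2n\}$ is a basis of the flag descent algebra consisting of orthogonal idempotents: $f_i^2=f_i$ for all $i$ and $f_if_j=0$ for $i\ne j$.
   Context: Let $n\ge 1$. The hyperoctahedral group $\mathfrak{B}_n$ is the group (under composition of functions) of all bijections $\pi$ of $\{-n,\ldots,-1,0,1,\ldots,n\}$ with $\pi(-i)=-\pi(i)$ for all $i$. For $\pi\in\mathfrak{B}_n$, $\mathrm{des}_A(\pi)=|\{i\in\{1,\ldots,n-1\}:\pi(i)>\pi(i+1)\}|$, $\mathrm{des}_B(\pi)=|\{i\in\{0,\ldots,n-1\}:\pi(i)>\pi(i+1)\}|$ (with $\pi(0)=0$), and $\mathrm{fdes}(\pi)=\mathrm{des}_A(\pi)+\mathrm{des}_B(\pi)$. The flag descent algebra is the linear span in $\mathbb{Q}[\mathfrak{B}_n]$ of the elements $F_i=\sum_{\mathrm{fdes}(\pi)=i}\pi$, $0\le i\le 2n-1$. The elements $a_1,\ldots,a_n$ and $b_0,\ldots,b_n$ of $\mathbb{Q}[\mathfrak{B}_n]$ are defined by the polynomial expansions in $x$ $$\sum_{\pi\in\mathfrak{B}_n}\binom{\frac{x}{2}+n-1-\mathrm{des}_A(\pi)}{n}\pi=\sum_{i=1}^n a_ix^i,\qquad \sum_{\pi\in\mathfrak{B}_n}\binom{\frac{x-1}{2}+n-\mathrm{des}_B(\pi)}{n}\pi=\sum_{i=0}^n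 b_ix^i,$$ where $\binom{z}{n}=z(z-1)\cdots(z-n+1)/n!$. *)

theory Defs
  imports
    Complex_Main
    "HOL-Library.Poly_Mapping"
    "HOL-Combinatorics.Permutations"
    "HOL-Computational_Algebra.Polynomial"
begin

text \<open>Outside \<open>{-n..n}\<close> the elements are the identity, by the definition of \<open>permutes\<close>,
  so quantifying over all \<open>i\<close> in the second condition is harmless.\<close>

definition hyperoctahedral :: "nat \<Rightarrow> (int \<Rightarrow> int) set" where
  "hyperoctahedral n = {\<pi>. \<pi> permutes {- int n..int n} \<and> (\<forall>i. \<pi> (- i) = - \<pi> i)}"

definition des_A :: "nat \<Rightarrow> (int \<Rightarrow> int) \<Rightarrow> nat" where
  "des_A n \<pi> = card {i \<in> {1..int n - 1}. \<pi> i > \<pi> (i + 1)}"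

definition des_B :: "nat \<Rightarrow> (int \<Rightarrow> int) \<Rightarrow> nat" where
  "des_B n \<pi> = card {i \<in> {0..int n - 1}. \<pi> i > \<pi> (i + 1)}"

definition fdes :: "nat \<Rightarrow> (int \<Rightarrow> int) \<Rightarrow> nat" where
  "fdes n \<pi> = des_A n \<pi> + des_B n \<pi>"

text \<open>Elements of the group algebra of \<open>hyperoctahedral n\<close> over the rationals are finite formal
  rational combinations of functions with support in \<open>hyperoctahedral n\<close>. The product is the
  bilinear extension of composition; it does not depend on \<open>n\<close>, so all these group algebras live
  inside the type below.\<close>

type_synonym galg = "(int \<Rightarrow> int) \<Rightarrow>\<^sub>0 rat"

definition gscale :: "rat \<Rightarrow> galg \<Rightarrow> galg" where
  "gscale c u = Poly_Mapping.map ((*) c) u"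

definition gmult :: "galg \<Rightarrow> galg \<Rightarrow> galg" (infixl \<open>\<star>\<close> 70) where
  "u \<star> v = (\<Sum>\<pi>\<in>Poly_Mapping.keys u. \<Sum>\<sigma>\<in>Poly_Mapping.keys v.
     Poly_Mapping.single (\<pi> \<circ> \<sigma>) (Poly_Mapping.lookup u \<pi> * Poly_Mapping.lookup v \<sigma>))"

lemma lookup_gscale [simp]: "Poly_Mapping.lookup (gscale c u) \<pi> = c * Poly_Mapping.lookup u \<pi>"
  unfolding gscale_def by (simp add: Poly_Mapping.map.rep_eq when_def)

global_interpretation galg: vector_space gscale
  by unfold_locales (auto intro!: poly_mapping_eqI simp: lookup_add algebra_simps)

definition flag_sum :: "nat \<Rightarrow> nat \<Rightarrow> galg" where
  "flag_sum n i = (\<Sum>\<pi> | \<pi> \<in> hyperoctahedral n \<and> fdes n \<pi> = i. Poly_Mapping.single \<pi> 1)"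

definition flag_descent_algebra :: "nat \<Rightarrow> galg set" where
  "flag_descent_algebra n = galg.span (flag_sum n ` {0..2 * n - 1})"

text \<open>The library's \<open>gchoose\<close> is only available in fields, hence not for polynomials.\<close>

definition poly_binom :: "rat poly \<Rightarrow> nat \<Rightarrow> rat poly" where
  "poly_binom p n = smult (1 / fact n) (\<Prod>k<n. p - of_nat k)"

lemma poly_poly_binom: "poly (poly_binom p n) x = poly p x gchoose n"
  by (simp add: poly_binom_def gbinomial_prod_rev poly_prod lessThan_atLeast0)

text \<open>The two generating functions, as polynomials in \<open>x\<close> with coefficients in the group algebra.
  Here \<open>[:c, 1/2:]\<close> is \<open>x/2 + c\<close>.\<close>

definition gen_A :: "nat \<Rightarrow> galg poly" where
  "gen_A n = (\<Sum>\<pi>\<in>hyperoctahedral n.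
     map_poly (Poly_Mapping.single \<pi>)
       (poly_binom [:of_nat n - 1 - of_nat (des_A n \<pi>), 1/2:] n))"

definition gen_B :: "nat \<Rightarrow> galg poly" where
  "gen_B n = (\<Sum>\<pi>\<in>hyperoctahedral n.
     map_poly (Poly_Mapping.single \<pi>)
       (poly_binom [:of_nat n - of_nat (des_B n \<pi>) - 1/2, 1/2:] n))"

text \<open>\<open>a_coeff n 0\<close> is set to \<open>0\<close> by convention, as the expansion of \<open>gen_A n\<close> starts at degree 1
  (lemma \<open>coeff_gen_A_0\<close> below).\<close>

definition a_coeff :: "nat \<Rightarrow> nat \<Rightarrow> galg" where
  "a_coeff n i = (if i = 0 then 0 else coeff (gen_A n) i)"

definition b_coeff :: "nat \<Rightarrow> nat \<Rightarrow> galg" where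
  "b_coeff n i = coeff (gen_B n) i"

definition flag_idem :: "nat \<Rightarrow> nat \<Rightarrow> galg" where
  "flag_idem n k = (if even k then a_coeff n (k div 2)
                    else b_coeff n (k div 2) - a_coeff n (k div 2))"

lemma degree_poly_binom_linear: "degree (poly_binom [:c, d:] n) \<le> n"
proof -
  have "degree (\<Prod>i<n. [:c, d:] - of_nat i) \<le> (\<Sum>i<n. degree ([:c, d:] - of_nat i))"
    using degree_prod_sum_le[of "{..<n}" "\<lambda>i. [:c, d:] - of_nat i"] by (simp add: o_def)
  also have "\<dots> \<le> (\<Sum>i<n. 1)"
    by (rule sum_mono) (auto simp: of_nat_poly)
  finally show ?thesis
    by (auto simp: poly_binom_def)
qed

lemma finite_hyperoctahedral: "finite (hyperoctahedral n)"
  by (rule finite_subset[OF _ finite_permutations[of "{- int n..int n}"]])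
    (auto simp: hyperoctahedral_def)

lemma des_A_le: "des_A n \<pi> \<le> n - 1"
proof -
  have "des_A n \<pi> \<le> card {1..int n - 1}"
    unfolding des_A_def by (rule card_mono) auto
  then show ?thesis by simp
qed

lemma coeff_gen_A_0:
  assumes "n \<ge> 1"
  shows "coeff (gen_A n) 0 = 0"
proof -
  have "coeff (poly_binom [:of_nat n - 1 - of_nat (des_A n \<pi>), 1/2:] n) 0 = (0 :: rat)" for \<pi>
  proof -
    have "(of_nat n - 1 - of_nat (des_A n \<pi>) :: rat) = of_nat (n - 1 - des_A n \<pi>)"
      using des_A_le[of n \<pi>] assms by (simp add: of_nat_diff)
    moreover have "(n - 1 - des_A n \<pi>) choose n = 0"
      using assms by (intro binomial_eq_0) auto
    ultimately show ?thesis
      by (simp add: poly_0_coeff_0[symmetric] poly_poly_binom binomial_gbinomial[symmetric]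
          del: of_nat_diff)
  qed
  then show ?thesis
    by (simp add: gen_A_def coeff_sum coeff_map_poly)
qed

lemma degree_gen_A: "degree (gen_A n) \<le> n"
proof (rule degree_le, intro allI impI)
  fix i assume "n < i"
  then have "coeff (poly_binom [:c, d:] n) i = 0" for c d
    using degree_poly_binom_linear[of c d n] by (intro coeff_eq_0) linarith
  then show "coeff (gen_A n) i = 0"
    by (simp add: gen_A_def coeff_sum coeff_map_poly)
qed

lemma degree_gen_B: "degree (gen_B n) \<le> n"
proof (rule degree_le, intro allI impI)
  fix i assume "n < i"
  then have "coeff (poly_binom [:c, d:] n) i = 0" for c d
    using degree_poly_binom_linear[of c d n] by (intro coeff_eq_0) linarith
  then show "coeff (gen_B n) i = 0"
    by (simp add: gen_B_def coeff_sum coeff_map_poly)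
qed

end

theory Submission
  imports Defs
begin

text \<open>For \<open>x \<ge> 0\<close> let \<open>V x\<close> be the set of the \<open>x\<close> integers \<open>-(x-1), -(x-3), ..., x-1\<close>. An odd map
  \<open>f\<close> on \<open>{-n..n}\<close> with values in \<open>V x\<close> away from \<open>0\<close> is sorted, ties being broken by the
  argument, by a unique signed permutation. Let \<open>\<Phi> x\<close> be the sum of these permutations over all
  \<open>f\<close>. Counting the maps sorted by a given \<open>\<pi>\<close> shows that \<open>\<Phi> x\<close> is the value of the first
  generating function if \<open>x\<close> is even and of the second if \<open>x\<close> is odd. The pairs \<open>(g, f)\<close> with
  values in \<open>V y \<times> V x\<close>, ordered lexicographically, are encoded by \<open>x g + f\<close> with values in
  \<open>V (x y)\<close>, and sorting by \<open>f\<close> and then by \<open>g\<close> is sorting by the pair, so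
  \<open>\<Phi> x \<star> \<Phi> y = \<Phi> (x y)\<close>. Comparing coefficients gives \<open>a\<^sub>i a\<^sub>j = a\<^sub>i b\<^sub>j = b\<^sub>i a\<^sub>j = \<delta>\<^sub>i\<^sub>j a\<^sub>i\<close>
  and \<open>b\<^sub>i b\<^sub>j = \<delta>\<^sub>i\<^sub>j b\<^sub>i\<close>, hence the orthogonal idempotents.

  For the basis property, \<open>\<Phi> x\<close> lies in the span of the idempotents and equals \<open>F\<^sub>i\<close> with
  \<open>i = x - 1\<close> plus a combination of the \<open>F\<^sub>j\<close> with \<open>j < i\<close>; the \<open>2 n\<close> elements \<open>F\<^sub>i\<close> are linearly
  independent since every flag descent number occurs.\<close>

subsection \<open>Bilinearity of the product\<close>

text \<open>Summands outside the supports vanish. Choosing one index set that covers several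
  supports makes the product visibly additive in each factor.\<close>

lemma gmult_eq_sum_superset:
  assumes "finite A" "finite B" "Poly_Mapping.keys u \<subseteq> A" "Poly_Mapping.keys v \<subseteq> B"
  shows "u \<star> v = (\<Sum>\<pi>\<in>A. \<Sum>\<sigma>\<in>B.
     Poly_Mapping.single (\<pi> \<circ> \<sigma>) (Poly_Mapping.lookup u \<pi> * Poly_Mapping.lookup v \<sigma>))"
proof -
  have "u \<star> v = (\<Sum>\<pi>\<in>Poly_Mapping.keys u. \<Sum>\<sigma>\<in>B.
     Poly_Mapping.single (\<pi> \<circ> \<sigma>) (Poly_Mapping.lookup u \<pi> * Poly_Mapping.lookup v \<sigma>))"
    unfolding gmult_def using assms
    by (intro sum.cong[OF refl] sum.mono_neutral_left) (auto simp: in_keys_iff)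
  also have "\<dots> = (\<Sum>\<pi>\<in>A. \<Sum>\<sigma>\<in>B.
     Poly_Mapping.single (\<pi> \<circ> \<sigma>) (Poly_Mapping.lookup u \<pi> * Poly_Mapping.lookup v \<sigma>))"
    using assms by (intro sum.mono_neutral_left) (auto simp: in_keys_iff)
  finally show ?thesis .
qed

lemma gmult_zero_left [simp]: "0 \<star> v = 0"
  by (simp add: gmult_def)

lemma gmult_zero_right [simp]: "u \<star> 0 = 0"
  by (simp add: gmult_def)

lemma gmult_add_left: "(u + u') \<star> v = u \<star> v + u' \<star> v"
  by (simp add: gmult_eq_sum_superset[of "Poly_Mapping.keys u \<union> Poly_Mapping.keys u'"
        "Poly_Mapping.keys v"] Poly_Mapping.keys_add lookup_add distrib_right single_add sum.distrib)

lemma gmult_add_right: "u \<star> (v + v') = u \<star> v + u \<star> v'"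
  by (simp add: gmult_eq_sum_superset[of "Poly_Mapping.keys u"
        "Poly_Mapping.keys v \<union> Poly_Mapping.keys v'"] Poly_Mapping.keys_add lookup_add
        distrib_left single_add sum.distrib)

lemma gscale_single: "gscale c (Poly_Mapping.single \<pi> d) = Poly_Mapping.single \<pi> (c * d)"
  by (rule poly_mapping_eqI) (simp add: lookup_single when_def)

lemma keys_gscale_subset: "Poly_Mapping.keys (gscale c u) \<subseteq> Poly_Mapping.keys u"
  by (auto simp: in_keys_iff)

lemma gmult_gscale_left: "gscale c u \<star> v = gscale c (u \<star> v)"
  by (simp add: gmult_eq_sum_superset[of "Poly_Mapping.keys u" "Poly_Mapping.keys v"]
        keys_gscale_subset galg.scale_sum_right gscale_single mult.assoc)

lemma gmult_gscale_right: "u \<star> gscale c v = gscale c (u \<star> v)"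
  by (simp add: gmult_eq_sum_superset[of "Poly_Mapping.keys u" "Poly_Mapping.keys v"]
        keys_gscale_subset galg.scale_sum_right gscale_single mult.left_commute)

lemma gmult_diff_left: "(u - u') \<star> v = u \<star> v - u' \<star> v"
  using gmult_add_left[of "u - u'" u' v] by (simp add: algebra_simps)

lemma gmult_diff_right: "u \<star> (v - v') = u \<star> v - u \<star> v'"
  using gmult_add_right[of u "v - v'" v'] by (simp add: algebra_simps)

lemma gmult_sum_left: "(\<Sum>i\<in>I. u i) \<star> v = (\<Sum>i\<in>I. u i \<star> v)"
  by (induction I rule: infinite_finite_induct) (simp_all add: gmult_add_left)

lemma gmult_sum_right: "u \<star> (\<Sum>i\<in>I. v i) = (\<Sum>i\<in>I. u \<star> v i)"
  by (induction I rule: infinite_finite_induct) (simp_all add: gmult_add_right)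

lemma gmult_single:
  "Poly_Mapping.single \<pi> c \<star> Poly_Mapping.single \<sigma> d = Poly_Mapping.single (\<pi> \<circ> \<sigma>) (c * d)"
  by (simp add: gmult_eq_sum_superset[of "{\<pi>}" "{\<sigma>}"])

subsection \<open>Polynomials with coefficients in the group algebra\<close>

text \<open>A polynomial with coefficients \<open>c\<close> taken at a rational scalar, whereas
  \<open>poly\<close> would expect an argument of the coefficient type.\<close>

definition galg_eval :: "nat \<Rightarrow> (nat \<Rightarrow> galg) \<Rightarrow> rat \<Rightarrow> galg" where
  "galg_eval n c x = (\<Sum>i\<le>n. gscale (x ^ i) (c i))"

lemma lookup_galg_eval:
  "Poly_Mapping.lookup (galg_eval n c x) \<pi> = (\<Sum>i\<le>n. Poly_Mapping.lookup (c i) \<pi> * x ^ i)"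
  by (simp add: galg_eval_def lookup_sum mult.commute)

text \<open>Reading off the coefficient at a fixed group element leaves a rational polynomial with
  infinitely many roots.\<close>

lemma galg_eval_eq_0_imp_coeff_eq_0:
  assumes "infinite X" "\<And>x. x \<in> X \<Longrightarrow> galg_eval n c x = 0" "i \<le> n"
  shows "c i = 0"
proof (rule poly_mapping_eqI)
  fix \<pi>
  define p where "p = (\<Sum>i\<le>n. monom (Poly_Mapping.lookup (c i) \<pi>) i)"
  have "poly p x = Poly_Mapping.lookup (galg_eval n c x) \<pi>" for x
    by (simp add: p_def poly_sum poly_monom lookup_galg_eval)
  then have "X \<subseteq> {x. poly p x = 0}"
    using assms(2) by auto
  then have "p = 0"
    using assms(1) poly_roots_finite[of p] finite_subset by blast
  then have "coeff p i = 0" by simp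
  then show "Poly_Mapping.lookup (c i) \<pi> = Poly_Mapping.lookup 0 \<pi>"
    using assms(3) by (simp add: p_def coeff_sum)
qed

text \<open>The right-hand side contains only the diagonal monomials \<open>x^i * y^i\<close>, hence
  the Kronecker delta. Three families \<open>c\<close>, \<open>d\<close>, \<open>e\<close> are
  allowed because the parities of \<open>x\<close>, \<open>y\<close> and \<open>x * y\<close> decide
  which generating function appears.\<close>

lemma coeff_gmult_of_eval_gmult:
  assumes "infinite X" "infinite Y"
    and eq: "\<And>x y. x \<in> X \<Longrightarrow> y \<in> Y \<Longrightarrow>
      galg_eval n c x \<star> galg_eval n d y = galg_eval n e (x * y)"
    and "i \<le> n" "j \<le> n"
  shows "c i \<star> d j = (if i = j then e i else 0)"
proof -
  \<comment> \<open>Fix \<open>y\<close> and compare the coefficients of \<open>x^i\<close>.\<close>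
  have eq1: "c i \<star> galg_eval n d y = gscale (y ^ i) (e i)" if "y \<in> Y" for y
  proof -
    have "galg_eval n (\<lambda>i. c i \<star> galg_eval n d y - gscale (y ^ i) (e i)) x = 0" if "x \<in> X" for x
      using eq[OF that \<open>y \<in> Y\<close>]
      by (simp add: galg_eval_def gmult_sum_left gmult_gscale_left galg.scale_right_diff_distrib
          sum_subtractf power_mult_distrib)
    from galg_eval_eq_0_imp_coeff_eq_0[OF assms(1) this \<open>i \<le> n\<close>] show ?thesis by simp
  qed
  \<comment> \<open>Now compare the coefficients of \<open>y^j\<close>; the right-hand side of
    \<open>eq1\<close> contributes to \<open>j = i\<close> only.\<close>
  have "galg_eval n (\<lambda>j. c i \<star> d j - (if i = j then e i else 0)) y = 0" if "y \<in> Y" for y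
  proof -
    have "gscale (y ^ k) (c i \<star> d k - (if i = k then e i else 0))
        = gscale (y ^ k) (c i \<star> d k) - (if i = k then gscale (y ^ i) (e i) else 0)" for k
      by (simp add: galg.scale_right_diff_distrib)
    then have "galg_eval n (\<lambda>j. c i \<star> d j - (if i = j then e i else 0)) y
        = c i \<star> galg_eval n d y - (\<Sum>j\<le>n. if i = j then gscale (y ^ i) (e i) else 0)"
      by (simp add: galg_eval_def gmult_sum_right gmult_gscale_right sum_subtractf)
    then show ?thesis
      using eq1[OF that] \<open>i \<le> n\<close> by (simp add: sum.delta')
  qed
  from galg_eval_eq_0_imp_coeff_eq_0[OF assms(2) this \<open>j \<le> n\<close>] show ?thesis by simp
qed

section \<open>Values of the two generating functions at even and odd numbers\<close>

lemma lookup_coeff_gen_A: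
  "Poly_Mapping.lookup (coeff (gen_A n) i) \<pi> = (if \<pi> \<in> hyperoctahedral n
     then coeff (poly_binom [:of_nat n - 1 - of_nat (des_A n \<pi>), 1/2:] n) i else 0)"
  by (simp add: gen_A_def coeff_sum coeff_map_poly lookup_sum lookup_single when_def
      finite_hyperoctahedral)

lemma lookup_coeff_gen_B:
  "Poly_Mapping.lookup (coeff (gen_B n) i) \<pi> = (if \<pi> \<in> hyperoctahedral n
     then coeff (poly_binom [:of_nat n - of_nat (des_B n \<pi>) - 1/2, 1/2:] n) i else 0)"
  by (simp add: gen_B_def coeff_sum coeff_map_poly lookup_sum lookup_single when_def
      finite_hyperoctahedral)

lemma des_B_le: "des_B n \<pi> \<le> n"
proof -
  have "des_B n \<pi> \<le> card {0..int n - 1}"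
    unfolding des_B_def by (rule card_mono) auto
  then show ?thesis by simp
qed

lemma sum_coeff_poly_binom:
  "(\<Sum>i\<le>n. coeff (poly_binom [:c, d:] n) i * x ^ i) = (c + x * d) gchoose n"
proof -
  have "(\<Sum>i\<le>n. coeff (poly_binom [:c, d:] n) i * x ^ i) = poly (poly_binom [:c, d:] n) x"
    unfolding poly_altdef using degree_poly_binom_linear[of c d n]
    by (intro sum.mono_neutral_right) (auto simp: coeff_eq_0)
  then show ?thesis by (simp add: poly_poly_binom)
qed

text \<open>An even argument makes the upper entry of the binomial an integer, nonnegative by
  \<open>des_A_le\<close>, so the natural subtraction is exact and the value can be matched with a
  cardinality.\<close>

lemma lookup_eval_gen_A:
  assumes "n \<ge> 1"
  shows "Poly_Mapping.lookup (galg_eval n (coeff (gen_A n)) (of_nat (2 * k))) \<pi>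
    = (if \<pi> \<in> hyperoctahedral n then of_nat ((n + k - 1 - des_A n \<pi>) choose n) else 0)"
proof -
  have "(of_nat n - 1 - of_nat (des_A n \<pi>) + of_nat (2 * k) * (1/2) :: rat)
      = of_nat (n + k - 1 - des_A n \<pi>)"
    using des_A_le[of n \<pi>] assms by (simp add: of_nat_diff)
  then show ?thesis
    by (simp add: lookup_galg_eval lookup_coeff_gen_A sum_coeff_poly_binom binomial_gbinomial
        del: of_nat_mult of_nat_diff)
qed

lemma lookup_eval_gen_B:
  shows "Poly_Mapping.lookup (galg_eval n (coeff (gen_B n)) (of_nat (2 * k + 1))) \<pi>
    = (if \<pi> \<in> hyperoctahedral n then of_nat ((n + k - des_B n \<pi>) choose n) else 0)"
proof -
  have "(of_nat n - of_nat (des_B n \<pi>) - 1/2 + of_nat (2 * k + 1) * (1/2) :: rat)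
      = of_nat (n + k - des_B n \<pi>)"
    using des_B_le[of n \<pi>] by (simp add: of_nat_diff field_simps)
  then show ?thesis
    by (simp add: lookup_galg_eval lookup_coeff_gen_B sum_coeff_poly_binom binomial_gbinomial
        del: of_nat_mult of_nat_diff of_nat_add)
qed

subsection \<open>Sorting odd maps\<close>

definition prec :: "(int \<Rightarrow> int) \<Rightarrow> int \<Rightarrow> int \<Rightarrow> bool" where
  "prec f a b \<longleftrightarrow> f a < f b \<or> f a = f b \<and> a < b"

text \<open>Convention: \<open>\<pi>\<close> sends positions to arguments, so that
  \<open>f \<circ> \<pi>\<close> is weakly increasing.\<close>

definition sorts :: "nat \<Rightarrow> (int \<Rightarrow> int) \<Rightarrow> (int \<Rightarrow> int) \<Rightarrow> bool" where
  "sorts n f \<pi> \<longleftrightarrow> \<pi> permutes {- int n..int n} \<and>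
     (\<forall>i\<in>{- int n..int n}. \<forall>j\<in>{- int n..int n}. i < j \<longrightarrow> prec f (\<pi> i) (\<pi> j))"

definition sorting :: "nat \<Rightarrow> (int \<Rightarrow> int) \<Rightarrow> int \<Rightarrow> int" where
  "sorting n f = (THE \<pi>. sorts n f \<pi>)"

text \<open>Two arguments in \<open>{-n..n}\<close> differ by at most \<open>2 n\<close>, so the
  factor \<open>2 n + 1\<close> lets \<open>f\<close> dominate the tie-breaker. This turns
  \<open>prec\<close> into the usual order on integers.\<close>

definition lex_key :: "nat \<Rightarrow> (int \<Rightarrow> int) \<Rightarrow> int \<Rightarrow> int" where
  "lex_key n f m = (2 * int n + 1) * f m + m"

lemma prec_imp_lex_key_less:
  assumes "a \<in> {- int n..int n}" "b \<in> {- int n..int n}" "prec f a b"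
  shows "lex_key n f a < lex_key n f b"
proof (cases "f a < f b")
  case True
  then have "(2 * int n + 1) * (f a + 1) \<le> (2 * int n + 1) * f b"
    by (intro mult_left_mono) auto
  then show ?thesis
    using assms(1,2) by (simp add: lex_key_def algebra_simps)
qed (use assms in \<open>auto simp: prec_def lex_key_def\<close>)

lemma prec_linear: "prec f a b \<or> a = b \<or> prec f b a"
  by (auto simp: prec_def)

lemma lex_key_less_iff:
  assumes "a \<in> {- int n..int n}" "b \<in> {- int n..int n}"
  shows "lex_key n f a < lex_key n f b \<longleftrightarrow> prec f a b"
  using prec_imp_lex_key_less[OF assms, of f] prec_imp_lex_key_less[OF assms(2,1), of f]
    prec_linear[of f a b] by fastforce

lemma inj_on_lex_key: "inj_on (lex_key n f) {- int n..int n}"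
proof (rule inj_onI)
  fix a b assume *: "a \<in> {- int n..int n}" "b \<in> {- int n..int n}" "lex_key n f a = lex_key n f b"
  then show "a = b"
    using prec_linear[of f a b] lex_key_less_iff[OF *(1,2), of f] lex_key_less_iff[OF *(2,1), of f]
    by simp
qed

lemma sorts_list:
  assumes "sorts n f \<pi>"
  shows "sorted_wrt (<) (map (\<lambda>i. lex_key n f (\<pi> i)) [- int n..int n])"
    "set (map (\<lambda>i. lex_key n f (\<pi> i)) [- int n..int n]) = lex_key n f ` {- int n..int n}"
proof -
  have p: "\<pi> permutes {- int n..int n}" using assms by (simp add: sorts_def)
  show "sorted_wrt (<) (map (\<lambda>i. lex_key n f (\<pi> i)) [- int n..int n])"
    unfolding sorted_wrt_map
  proof (rule sorted_wrt_mono_rel[OF _ sorted_wrt_upto])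
    fix i j assume "i \<in> set [- int n..int n]" "j \<in> set [- int n..int n]" "i < j"
    then show "lex_key n f (\<pi> i) < lex_key n f (\<pi> j)"
      using assms permutes_in_image[OF p] by (intro prec_imp_lex_key_less) (auto simp: sorts_def)
  qed
  have "set (map (\<lambda>i. lex_key n f (\<pi> i)) [- int n..int n])
      = lex_key n f ` (\<pi> ` {- int n..int n})" by auto
  then show "set (map (\<lambda>i. lex_key n f (\<pi> i)) [- int n..int n]) = lex_key n f ` {- int n..int n}"
    by (simp add: permutes_image[OF p])
qed

text \<open>A strictly increasing list is determined by its set of entries. Hence both permutations
  give the same list of keys, and keys determine arguments.\<close>

lemma sorts_unique:
  assumes "sorts n f \<pi>" "sorts n f \<sigma>"
  shows "\<pi> = \<sigma>"
proof
  fix i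
  have p: "\<pi> permutes {- int n..int n}" "\<sigma> permutes {- int n..int n}"
    using assms by (simp_all add: sorts_def)
  have eq: "map (\<lambda>i. lex_key n f (\<pi> i)) [- int n..int n]
      = map (\<lambda>i. lex_key n f (\<sigma> i)) [- int n..int n]"
    by (rule strict_sorted_equal) (use sorts_list[OF assms(1)] sorts_list[OF assms(2)] in auto)
  show "\<pi> i = \<sigma> i"
  proof (cases "i \<in> {- int n..int n}")
    case True
    then have "lex_key n f (\<pi> i) = lex_key n f (\<sigma> i)" using eq by auto
    then show ?thesis
      using True permutes_in_image[OF p(1)] permutes_in_image[OF p(2)]
      by (intro inj_onD[OF inj_on_lex_key[of n f], of "\<pi> i"]) auto
  qed (simp add: permutes_not_in[OF p(1)] permutes_not_in[OF p(2)])
qed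

text \<open>Sort the keys and let \<open>\<pi> i\<close> be the argument whose key stands at index
  \<open>i + n\<close>, the shift accounting for lists being indexed from 0.\<close>

lemma sorts_exists: "\<exists>\<pi>. sorts n f \<pi>"
proof -
  let ?N = "{- int n..int n}"
  define ys where "ys = sorted_list_of_set (lex_key n f ` ?N)"
  have len: "length ys = 2 * n + 1"
    by (simp add: ys_def card_image[OF inj_on_lex_key])
  have set_ys: "set ys = lex_key n f ` ?N" by (simp add: ys_def)
  have srt: "sorted_wrt (<) ys" by (simp add: ys_def)
  have dist: "distinct ys" by (simp add: ys_def)
  define g where "g i = the_inv_into ?N (lex_key n f) (ys ! nat (i + int n))" for i
  have b1: "bij_betw (\<lambda>i. nat (i + int n)) ?N {..<2 * n + 1}"
    by (rule bij_betw_byWitness[where f' = "\<lambda>k. int k - int n"]) auto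
  have b2: "bij_betw ((!) ys) {..<2 * n + 1} (lex_key n f ` ?N)"
    using bij_betw_nth[OF dist, of "{..<2 * n + 1}" "lex_key n f ` ?N"] len set_ys by simp
  have b3: "bij_betw (the_inv_into ?N (lex_key n f)) (lex_key n f ` ?N) ?N"
    by (rule bij_betw_the_inv_into) (simp add: bij_betw_def inj_on_lex_key)
  have g: "bij_betw g ?N ?N"
    using bij_betw_trans[OF b1 bij_betw_trans[OF b2 b3]] by (simp add: o_def g_def[abs_def])
  define \<pi> where "\<pi> i = (if i \<in> ?N then g i else i)" for i
  have "bij_betw \<pi> ?N ?N" using g bij_betw_cong[of ?N \<pi> g ?N] by (simp add: \<pi>_def)
  then have p: "\<pi> permutes ?N" by (rule bij_imp_permutes) (auto simp: \<pi>_def)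
  have key: "lex_key n f (\<pi> i) = ys ! nat (i + int n)" if "i \<in> ?N" for i
  proof -
    have "ys ! nat (i + int n) \<in> lex_key n f ` ?N"
      using that len set_ys nth_mem[of "nat (i + int n)" ys] by auto
    then show ?thesis
      using that by (simp add: \<pi>_def g_def f_the_inv_into_f[OF inj_on_lex_key])
  qed
  have "prec f (\<pi> i) (\<pi> j)" if "i \<in> ?N" "j \<in> ?N" "i < j" for i j
  proof -
    have "ys ! nat (i + int n) < ys ! nat (j + int n)"
      using that len by (intro sorted_wrt_nth_less[OF srt]) auto
    then show ?thesis
      using that permutes_in_image[OF p] by (subst lex_key_less_iff[of _ n, symmetric]) (auto simp: key)
  qed
  then show ?thesis using p by (auto simp: sorts_def)
qed

lemma sorts_sorting: "sorts n f (sorting n f)"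
  unfolding sorting_def using sorts_exists sorts_unique by (metis theI)

lemma sorting_eq_iff: "sorting n f = \<pi> \<longleftrightarrow> sorts n f \<pi>"
  using sorts_sorting sorts_unique by metis

text \<open>For odd \<open>f\<close>, negation reverses \<open>prec\<close>. Hence
  \<open>i \<mapsto> - \<pi> (- i)\<close> sorts \<open>f\<close> as well, and uniqueness makes it
  equal to \<open>\<pi>\<close>.\<close>

lemma sorting_in_hyperoctahedral:
  assumes "\<And>i. f (- i) = - f i"
  shows "sorting n f \<in> hyperoctahedral n"
proof -
  let ?N = "{- int n..int n}"
  let ?\<pi> = "sorting n f"
  let ?\<sigma> = "\<lambda>i. - ?\<pi> (- i)"
  have s: "sorts n f ?\<pi>" by (rule sorts_sorting)
  then have p: "?\<pi> permutes ?N" by (simp add: sorts_def)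
  have neg: "bij_betw uminus ?N ?N"
    by (rule bij_betw_byWitness[where f' = uminus]) auto
  have "bij_betw ?\<sigma> ?N ?N"
    using bij_betw_trans[OF neg bij_betw_trans[OF permutes_imp_bij[OF p] neg]] by (simp add: o_def)
  then have p': "?\<sigma> permutes ?N"
    by (rule bij_imp_permutes) (auto simp: permutes_not_in[OF p])
  have "prec f (- b) (- a) \<longleftrightarrow> prec f a b" for a b
    by (auto simp: prec_def assms)
  then have "sorts n f ?\<sigma>"
    using s p' by (auto simp: sorts_def)
  then have "?\<pi> = ?\<sigma>" using s sorts_unique by blast
  then have "?\<pi> (- i) = - ?\<pi> i" for i by (metis minus_minus)
  then show ?thesis using p by (simp add: hyperoctahedral_def)
qed

subsection \<open>Multiplicativity\<close>

definition grid :: "nat \<Rightarrow> int set" where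
  "grid x = {v. \<bar>v\<bar> < int x \<and> odd (v + int x)}"

text \<open>The value at 0 is 0 even when \<open>x\<close> is even and 0 is not in
  \<open>grid x\<close>. Vanishing outside \<open>{-n..n}\<close> makes the set finite.\<close>

definition odd_maps :: "nat \<Rightarrow> nat \<Rightarrow> (int \<Rightarrow> int) set" where
  "odd_maps n x = {f. (\<forall>i. f (- i) = - f i) \<and>
     (\<forall>i. (i \<in> {- int n..int n} - {0} \<longrightarrow> f i \<in> grid x) \<and>
          (i \<notin> {- int n..int n} - {0} \<longrightarrow> f i = 0))}"

definition shuffle_sum :: "nat \<Rightarrow> nat \<Rightarrow> galg" where
  "shuffle_sum n x = (\<Sum>f\<in>odd_maps n x. Poly_Mapping.single (sorting n f) 1)"

lemma odd_mapsI:
  assumes "\<And>i. f (- i) = - f i" "\<And>i. i \<in> {- int n..int n} - {0} \<Longrightarrow> f i \<in> grid x"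
    and "\<And>i. i \<notin> {- int n..int n} - {0} \<Longrightarrow> f i = 0"
  shows "f \<in> odd_maps n x"
  unfolding odd_maps_def using assms by blast

lemma odd_mapsD:
  assumes "f \<in> odd_maps n x"
  shows "f (- i) = - f i" "i \<in> {- int n..int n} - {0} \<Longrightarrow> f i \<in> grid x"
    "i \<notin> {- int n..int n} - {0} \<Longrightarrow> f i = 0"
  using assms unfolding odd_maps_def by blast+

lemma finite_grid: "finite (grid x)"
  by (rule finite_subset[of _ "{- int x..int x}"]) (auto simp: grid_def)

lemma finite_odd_maps: "finite (odd_maps n x)"
  by (rule finite_subset[OF _ finite_set_of_finite_funs[of "{- int n..int n} - {0}" "grid x" 0]])
    (auto simp: odd_maps_def finite_grid)

lemma uminus_in_grid: "v \<in> grid x \<Longrightarrow> - v \<in> grid x"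
  by (auto simp: grid_def)

text \<open>Elements of \<open>grid y\<close> share their parity, so \<open>g\<close> rises by at
  least 2 and \<open>x g\<close> by at least \<open>2 x\<close>, which exceeds any difference of two
  elements of \<open>grid x\<close>.\<close>

lemma grid_lex_less:
  assumes "g \<in> grid y" "g' \<in> grid y" "f \<in> grid x" "f' \<in> grid x" "g < g'"
  shows "int x * g + f < int x * g' + f'"
proof -
  have "even (g' - g)" using assms(1,2) by (auto simp: grid_def)
  then have "g + 2 \<le> g'" using assms(5) by presburger
  then have "int x * (g + 2) \<le> int x * g'"
    by (intro mult_left_mono) auto
  moreover have "\<bar>f\<bar> < int x" "\<bar>f'\<bar> < int x"
    using assms(3,4) by (simp_all add: grid_def)
  ultimately show ?thesis unfolding distrib_left by linarith
qed

lemma grid_mult_unique: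
  assumes "g \<in> grid y" "g' \<in> grid y" "f \<in> grid x" "f' \<in> grid x"
    and "int x * g + f = int x * g' + f'"
  shows "g = g'" "f = f'"
proof -
  show "g = g'"
    using grid_lex_less[OF assms(1-4)] grid_lex_less[OF assms(2,1,4,3)] assms(5)
    by (cases g g' rule: linorder_cases) auto
  then show "f = f'" using assms(5) by simp
qed

text \<open>The map \<open>m \<mapsto> 2 m + 1 - x\<close> identifies \<open>{0..x-1}\<close> with
  \<open>grid x\<close>. Through it the claim becomes division with remainder by \<open>x\<close>,
  applied to the rank \<open>q\<close> of \<open>v\<close> in \<open>grid (x * y)\<close>.\<close>

lemma grid_mult_exists:
  assumes "v \<in> grid (x * y)"
  shows "\<exists>g\<in>grid y. \<exists>f\<in>grid x. v = int x * g + f"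
proof -
  define q where "q = (v + int x * int y - 1) div 2"
  have xy: "0 < int x * int y" and "odd (v + int x * int y)"
    and lt: "\<bar>v\<bar> < int x * int y"
    using assms by (auto simp: grid_def)
  then have v: "v = 2 * q + 1 - int x * int y" by (auto simp: q_def)
  have x: "0 < int x" using xy by (cases "x = 0") auto
  define d m where "d = q div int x" and "m = q mod int x"
  have q: "q = int x * d + m" by (simp add: d_def m_def)
  have m: "0 \<le> m" "m < int x" using x by (auto simp: m_def)
  have "0 \<le> q" using v lt by linarith
  have "q < int x * int y" using v lt by linarith
  have "0 \<le> d" using \<open>0 \<le> q\<close> x by (simp add: d_def pos_imp_zdiv_nonneg_iff)
  have "int x * d < int x * int y" using \<open>q < int x * int y\<close> q m by linarith
  then have "d < int y" using x by simp
  have "2 * d + 1 - int y \<in> grid y" "2 * m + 1 - int x \<in> grid x"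
    using m \<open>0 \<le> d\<close> \<open>d < int y\<close> by (auto simp: grid_def)
  moreover have "v = int x * (2 * d + 1 - int y) + (2 * m + 1 - int x)"
    using v q by (simp add: algebra_simps)
  ultimately show ?thesis by blast
qed

lemma grid_mult_in:
  assumes "g \<in> grid y" "f \<in> grid x"
  shows "int x * g + f \<in> grid (x * y)"
proof -
  have "\<bar>int x * g\<bar> \<le> int x * (int y - 1)"
    using assms(1) by (auto simp: abs_mult grid_def intro!: mult_left_mono)
  then have "\<bar>int x * g + f\<bar> < int x * int y"
    using assms(2) by (auto simp: grid_def algebra_simps)
  moreover have "odd (int x * g + f + int x * int y)"
    using assms by (auto simp: grid_def)
  ultimately show ?thesis by (simp add: grid_def)
qed

lemma bij_betw_odd_maps_mult:
  "bij_betw (\<lambda>(f, g) i. int x * g i + f i) (odd_maps n x \<times> odd_maps n y) (odd_maps n (x * y))"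
  unfolding bij_betw_def
proof (intro conjI equalityI subsetI)
  show "inj_on (\<lambda>(f, g) i. int x * g i + f i) (odd_maps n x \<times> odd_maps n y)"
  proof (rule inj_onI, clarsimp)
    fix f g f' g'
    assume *: "f \<in> odd_maps n x" "g \<in> odd_maps n y" "f' \<in> odd_maps n x" "g' \<in> odd_maps n y"
      and eq: "(\<lambda>i. int x * g i + f i) = (\<lambda>i. int x * g' i + f' i)"
    have "f i = f' i \<and> g i = g' i" for i
    proof (cases "i \<in> {- int n..int n} - {0}")
      case True
      then show ?thesis
        using grid_mult_unique[of "g i" y "g' i" "f i" x "f' i"] fun_cong[OF eq, of i]
          odd_mapsD(2)[OF *(1) True] odd_mapsD(2)[OF *(2) True]
          odd_mapsD(2)[OF *(3) True] odd_mapsD(2)[OF *(4) True] by simp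
    next
      case False
      show ?thesis
        using odd_mapsD(3)[OF *(1) False] odd_mapsD(3)[OF *(2) False]
          odd_mapsD(3)[OF *(3) False] odd_mapsD(3)[OF *(4) False] by simp
    qed
    then show "f = f' \<and> g = g'" by auto
  qed
next
  fix h assume "h \<in> (\<lambda>(f, g) i. int x * g i + f i) ` (odd_maps n x \<times> odd_maps n y)"
  then obtain f g where h: "h = (\<lambda>i. int x * g i + f i)"
    and fg: "f \<in> odd_maps n x" "g \<in> odd_maps n y" by auto
  show "h \<in> odd_maps n (x * y)"
  proof (rule odd_mapsI)
    show "h (- i) = - h i" for i using odd_mapsD(1)[OF fg(1)] odd_mapsD(1)[OF fg(2)] by (simp add: h)
    show "h i \<in> grid (x * y)" if "i \<in> {- int n..int n} - {0}" for i
      unfolding h using odd_mapsD(2)[OF fg(1) that] odd_mapsD(2)[OF fg(2) that] by (rule grid_mult_in[rotated])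
    show "h i = 0" if "i \<notin> {- int n..int n} - {0}" for i
      using odd_mapsD(3)[OF fg(1) that] odd_mapsD(3)[OF fg(2) that] by (simp add: h)
  qed
next
  fix h assume h: "h \<in> odd_maps n (x * y)"
  obtain G F where GF: "\<And>v. v \<in> grid (x * y) \<Longrightarrow>
      G v \<in> grid y \<and> F v \<in> grid x \<and> v = int x * G v + F v"
    using grid_mult_exists[of _ x y] by metis
  \<comment> \<open>The chosen digits are odd functions, since negating both digits of
    \<open>v\<close> gives a decomposition of \<open>- v\<close> and decompositions are
    unique.\<close>
  have neg: "G (- v) = - G v \<and> F (- v) = - F v" if "v \<in> grid (x * y)" for v
  proof -
    have "int x * G (- v) + F (- v) = int x * (- G v) + (- F v)"
      using GF[OF that] GF[OF uminus_in_grid[OF that]] by simp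
    with grid_mult_unique[of "G (- v)" y "- G v" "F (- v)" x "- F v"] show ?thesis
      using GF[OF that] GF[OF uminus_in_grid[OF that]] uminus_in_grid by simp
  qed
  let ?I = "{- int n..int n} - {0}"
  define f g where "f i = (if i \<in> ?I then F (h i) else 0)"
    and "g i = (if i \<in> ?I then G (h i) else 0)" for i
  have hg: "h i \<in> grid (x * y)" if "i \<in> ?I" for i
    using odd_mapsD(2)[OF h that] .
  have hodd: "h (- i) = - h i" for i
    using odd_mapsD(1)[OF h] .
  have I: "- i \<in> ?I \<longleftrightarrow> i \<in> ?I" for i by auto
  have "f \<in> odd_maps n x"
  proof (rule odd_mapsI)
    show "f (- i) = - f i" for i
      using neg[OF hg, of i] by (cases "i \<in> ?I") (simp_all only: f_def I hodd if_True if_False minus_zero)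
  qed (use GF hg in \<open>simp_all only: f_def if_True if_False\<close>)
  moreover have "g \<in> odd_maps n y"
  proof (rule odd_mapsI)
    show "g (- i) = - g i" for i
      using neg[OF hg, of i] by (cases "i \<in> ?I") (simp_all only: g_def I hodd if_True if_False minus_zero)
  qed (use GF hg in \<open>simp_all only: g_def if_True if_False\<close>)
  moreover have "h = (\<lambda>i. int x * g i + f i)"
  proof
    fix i show "h i = int x * g i + f i"
      using GF[OF hg, of i] odd_mapsD(3)[OF h, of i]
      by (cases "i \<in> ?I") (simp_all add: f_def g_def del: Diff_iff)
  qed
  ultimately show "h \<in> (\<lambda>(f, g) i. int x * g i + f i) ` (odd_maps n x \<times> odd_maps n y)"
    by auto
qed

section \<open>Composition of odd maps with signed permutations\<close>

lemma hyperoctahedral_0: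
  assumes "\<pi> \<in> hyperoctahedral n"
  shows "\<pi> 0 = 0"
proof -
  have "\<pi> (- 0) = - \<pi> 0" using assms unfolding hyperoctahedral_def by blast
  then show ?thesis by simp
qed

lemma hyperoctahedral_in_iff:
  assumes "\<pi> \<in> hyperoctahedral n"
  shows "\<pi> i \<in> {- int n..int n} - {0} \<longleftrightarrow> i \<in> {- int n..int n} - {0}"
proof -
  have p: "\<pi> permutes {- int n..int n}" using assms by (simp add: hyperoctahedral_def)
  have "\<pi> i = 0 \<longleftrightarrow> i = 0"
    using hyperoctahedral_0[OF assms] permutes_inj[OF p] by (metis injD)
  then show ?thesis using permutes_in_image[OF p, of i] by auto
qed

lemma odd_maps_comp:
  assumes "\<pi> \<in> hyperoctahedral n" "f \<in> odd_maps n x"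
  shows "f \<circ> \<pi> \<in> odd_maps n x"
proof -
  have o: "\<pi> (- i) = - \<pi> i" for i using assms(1) by (simp add: hyperoctahedral_def)
  show ?thesis
    using odd_mapsD[OF assms(2)] hyperoctahedral_in_iff[OF assms(1)] o
    unfolding o_def by (intro odd_mapsI) metis+
qed

lemma hyperoctahedral_inv:
  assumes "\<pi> \<in> hyperoctahedral n"
  shows "inv \<pi> \<in> hyperoctahedral n"
proof -
  have p: "\<pi> permutes {- int n..int n}" and o: "\<And>i. \<pi> (- i) = - \<pi> i"
    using assms by (auto simp: hyperoctahedral_def)
  have "inv \<pi> (- i) = - inv \<pi> i" for i
    by (metis o permutes_inverses[OF p])
  then show ?thesis using permutes_inv[OF p] by (simp add: hyperoctahedral_def)
qed

lemma bij_betw_odd_maps_comp: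
  assumes "\<pi> \<in> hyperoctahedral n"
  shows "bij_betw (\<lambda>f. f \<circ> \<pi>) (odd_maps n x) (odd_maps n x)"
proof -
  have p: "\<pi> permutes {- int n..int n}" using assms by (simp add: hyperoctahedral_def)
  show ?thesis
    using odd_maps_comp[OF assms] odd_maps_comp[OF hyperoctahedral_inv[OF assms]]
    by (intro bij_betw_byWitness[where f' = "\<lambda>f. f \<circ> inv \<pi>"])
      (auto simp: o_def permutes_inverses[OF p])
qed

text \<open>Extends \<open>grid_lex_less\<close> to arguments where the maps vanish, in particular
  to 0. There \<open>g\<close> may rise by only 1, but then one of the two values of
  \<open>f\<close> is 0 and the other has absolute value below \<open>x\<close>.\<close>

lemma odd_map_lex_less:
  assumes "f \<in> odd_maps n x" "g \<in> odd_maps n y" "g a < g b"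
  shows "int x * g a + f a < int x * g b + f b"
proof -
  let ?I = "{- int n..int n} - {0}"
  have in_grid: "i \<in> ?I \<Longrightarrow> f i \<in> grid x" "i \<in> ?I \<Longrightarrow> g i \<in> grid y"
    and zero: "i \<notin> ?I \<Longrightarrow> f i = 0" "i \<notin> ?I \<Longrightarrow> g i = 0" for i
    using odd_mapsD(2,3)[OF assms(1)] odd_mapsD(2,3)[OF assms(2)] by blast+
  have "a \<in> ?I \<or> b \<in> ?I" using assms(3) zero by fastforce
  then have x: "0 < int x" using in_grid(1)[of a] in_grid(1)[of b] by (auto simp: grid_def)
  show ?thesis
  proof (cases "a \<in> ?I \<and> b \<in> ?I")
    case True
    then show ?thesis using grid_lex_less assms(3) in_grid by blast
  next
    case False
    have "int x * (g a + 1) \<le> int x * g b"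
      using assms(3) by (intro mult_left_mono) auto
    moreover have "f a - f b < int x"
    proof -
      have "\<bar>f i\<bar> < int x" for i
        using in_grid(1)[of i] zero(1)[of i] x by (cases "i \<in> ?I") (auto simp: grid_def)
      moreover have "f a = 0 \<or> f b = 0" using False zero by blast
      ultimately show ?thesis by (smt (verit, best))
    qed
    ultimately show ?thesis by (simp add: algebra_simps)
  qed
qed

text \<open>Sorting first by \<open>f\<close> and then stably by \<open>g\<close> amounts to sorting by the pair \<open>(g, f)\<close>, which
  \<open>x g + f\<close> encodes as a single map.\<close>

lemma sorting_comp:
  assumes "f \<in> odd_maps n x" "g \<in> odd_maps n y"
  shows "sorting n f \<circ> sorting n (g \<circ> sorting n f) = sorting n (\<lambda>i. int x * g i + f i)"
proof -
  let ?N = "{- int n..int n}"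
  define \<pi> \<sigma> where "\<pi> = sorting n f" and "\<sigma> = sorting n (g \<circ> \<pi>)"
  have s: "sorts n f \<pi>" "sorts n (g \<circ> \<pi>) \<sigma>"
    by (simp_all add: \<pi>_def \<sigma>_def sorts_sorting)
  then have p: "\<pi> permutes ?N" "\<sigma> permutes ?N" by (simp_all add: sorts_def)
  have "prec (\<lambda>i. int x * g i + f i) (\<pi> (\<sigma> i)) (\<pi> (\<sigma> j))"
    if "i \<in> ?N" "j \<in> ?N" "i < j" for i j
  proof -
    have N: "\<sigma> i \<in> ?N" "\<sigma> j \<in> ?N" using that permutes_in_image[OF p(2)] by auto
    have "prec (g \<circ> \<pi>) (\<sigma> i) (\<sigma> j)" using s(2) that by (simp add: sorts_def)
    then consider "g (\<pi> (\<sigma> i)) < g (\<pi> (\<sigma> j))"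
      | "g (\<pi> (\<sigma> i)) = g (\<pi> (\<sigma> j))" "\<sigma> i < \<sigma> j"
      by (auto simp: prec_def)
    then show ?thesis
    proof cases
      case 1
      then show ?thesis using odd_map_lex_less[OF assms] by (simp add: prec_def)
    next
      case 2
      then have "prec f (\<pi> (\<sigma> i)) (\<pi> (\<sigma> j))" using s(1) N by (auto simp: sorts_def)
      then show ?thesis using 2(1) by (simp add: prec_def)
    qed
  qed
  then have "sorts n (\<lambda>i. int x * g i + f i) (\<pi> \<circ> \<sigma>)"
    using permutes_compose[OF p(2,1)] by (simp add: sorts_def)
  then show ?thesis by (metis \<pi>_def \<sigma>_def sorting_eq_iff)
qed

lemma shuffle_sum_mult: "shuffle_sum n x \<star> shuffle_sum n y = shuffle_sum n (x * y)"
proof -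
  have "shuffle_sum n x \<star> shuffle_sum n y = (\<Sum>f\<in>odd_maps n x. \<Sum>g\<in>odd_maps n y.
      Poly_Mapping.single (sorting n f \<circ> sorting n g) 1)"
    unfolding shuffle_sum_def gmult_sum_left by (simp add: gmult_sum_right gmult_single)
  also have "\<dots> = (\<Sum>f\<in>odd_maps n x. \<Sum>g\<in>odd_maps n y.
      Poly_Mapping.single (sorting n (\<lambda>i. int x * g i + f i)) 1)"
  proof (rule sum.cong[OF refl])
    fix f assume f: "f \<in> odd_maps n x"
    then have "sorting n f \<in> hyperoctahedral n"
      by (intro sorting_in_hyperoctahedral) (rule odd_mapsD)
    \<comment> \<open>For fixed \<open>f\<close>, replacing \<open>g\<close> by
      \<open>g \<circ> sorting n f\<close> permutes the odd maps and brings the summand into the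
      form of \<open>sorting_comp\<close>.\<close>
    then have "(\<Sum>g\<in>odd_maps n y. Poly_Mapping.single (sorting n f \<circ> sorting n g) 1)
      = (\<Sum>g\<in>odd_maps n y. Poly_Mapping.single (sorting n f \<circ> sorting n (g \<circ> sorting n f)) (1::rat))"
      by (intro sum.reindex_bij_betw[OF bij_betw_odd_maps_comp, symmetric])
    also have "\<dots> = (\<Sum>g\<in>odd_maps n y. Poly_Mapping.single (sorting n (\<lambda>i. int x * g i + f i)) 1)"
      using f by (intro sum.cong) (simp_all add: sorting_comp)
    finally show "(\<Sum>g\<in>odd_maps n y. Poly_Mapping.single (sorting n f \<circ> sorting n g) (1::rat))
      = (\<Sum>g\<in>odd_maps n y. Poly_Mapping.single (sorting n (\<lambda>i. int x * g i + f i)) 1)" .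
  qed
  also have "\<dots> = (\<Sum>p\<in>odd_maps n x \<times> odd_maps n y.
      Poly_Mapping.single (sorting n ((\<lambda>(f, g) i. int x * g i + f i) p)) 1)"
    by (simp add: sum.cartesian_product case_prod_unfold)
  also have "\<dots> = shuffle_sum n (x * y)"
    unfolding shuffle_sum_def by (rule sum.reindex_bij_betw[OF bij_betw_odd_maps_mult])
  finally show ?thesis .
qed

subsection \<open>Counting the maps sorted by a given signed permutation\<close>

text \<open>For \<open>D\<close> with values 0 and 1 these are the weakly increasing sequences from
  0 to at most \<open>k\<close> with a strict step wherever \<open>D j = 1\<close>. Zeros beyond
  \<open>m\<close> make each such sequence a unique function.\<close>

definition sparse_seqs :: "(nat \<Rightarrow> nat) \<Rightarrow> nat \<Rightarrow> nat \<Rightarrow> (nat \<Rightarrow> nat) set" where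
  "sparse_seqs D m k =
     {s. s 0 = 0 \<and> (\<forall>j<m. s j + D j \<le> s (Suc j)) \<and> s m \<le> k \<and> (\<forall>j>m. s j = 0)}"

lemma sparse_seqs_mono:
  assumes "s \<in> sparse_seqs D m k" "i \<le> j" "j \<le> m"
  shows "s i \<le> s j"
  using assms(2,3)
proof (induction rule: dec_induct)
  case (step j)
  then have "s j + D j \<le> s (Suc j)" using assms(1) by (simp add: sparse_seqs_def)
  then show ?case using step by simp
qed simp

lemma finite_sparse_seqs: "finite (sparse_seqs D m k)"
proof (rule finite_subset[OF _ finite_set_of_finite_funs[of "{..m}" "{..k}" 0]])
  show "sparse_seqs D m k \<subseteq> {f. \<forall>x. (x \<in> {..m} \<longrightarrow> f x \<in> {..k}) \<and> (x \<notin> {..m} \<longrightarrow> f x = 0)}"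
  proof
    fix s assume s: "s \<in> sparse_seqs D m k"
    then have "s j \<le> k" if "j \<le> m" for j
      using sparse_seqs_mono[OF s that] by (simp add: sparse_seqs_def)
    then show "s \<in> {f. \<forall>x. (x \<in> {..m} \<longrightarrow> f x \<in> {..k}) \<and> (x \<notin> {..m} \<longrightarrow> f x = 0)}"
      using s by (simp add: sparse_seqs_def)
  qed
qed simp_all

text \<open>Delete the last entry \<open>k\<close>; the entry before it is then bounded by
  \<open>k - D m\<close>.\<close>

lemma card_sparse_seqs_last:
  assumes "D m \<le> k"
  shows "card {s \<in> sparse_seqs D (Suc m) k. s (Suc m) = k} = card (sparse_seqs D m (k - D m))"
proof -
  have "bij_betw (\<lambda>s. s(Suc m := k)) (sparse_seqs D m (k - D m))
    {s \<in> sparse_seqs D (Suc m) k. s (Suc m) = k}"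
  proof (rule bij_betw_byWitness[where f' = "\<lambda>s. s(Suc m := 0)"])
    show "\<forall>s\<in>sparse_seqs D m (k - D m). s(Suc m := k, Suc m := 0) = s"
      by (auto simp: sparse_seqs_def fun_eq_iff)
    show "\<forall>s\<in>{s \<in> sparse_seqs D (Suc m) k. s (Suc m) = k}. s(Suc m := 0, Suc m := k) = s"
      by auto
    show "(\<lambda>s. s(Suc m := k)) ` sparse_seqs D m (k - D m)
        \<subseteq> {s \<in> sparse_seqs D (Suc m) k. s (Suc m) = k}"
      using assms by (auto simp: sparse_seqs_def less_Suc_eq)
    show "(\<lambda>s. s(Suc m := 0)) ` {s \<in> sparse_seqs D (Suc m) k. s (Suc m) = k}
        \<subseteq> sparse_seqs D m (k - D m)"
      by (force simp: sparse_seqs_def less_Suc_eq)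
  qed
  then show ?thesis by (rule bij_betw_same_card[symmetric])
qed

lemma card_sparse_seqs_Suc_Suc:
  assumes "D m \<le> 1"
  shows "card (sparse_seqs D (Suc m) (Suc k))
    = card (sparse_seqs D (Suc m) k) + card (sparse_seqs D m (Suc k - D m))"
proof -
  have "sparse_seqs D (Suc m) (Suc k)
      = sparse_seqs D (Suc m) k \<union> {s \<in> sparse_seqs D (Suc m) (Suc k). s (Suc m) = Suc k}"
    by (auto simp: sparse_seqs_def)
  moreover have "card (\<dots>) = card (sparse_seqs D (Suc m) k)
      + card {s \<in> sparse_seqs D (Suc m) (Suc k). s (Suc m) = Suc k}"
    by (intro card_Un_disjoint finite_sparse_seqs
        finite_subset[OF _ finite_sparse_seqs[of D "Suc m" "Suc k"]]) (auto simp: sparse_seqs_def)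
  ultimately show ?thesis using card_sparse_seqs_last[of D m "Suc k"] assms by simp
qed

text \<open>Splitting by whether the last entry attains the bound gives Pascal's rule, used in an
  inner induction on \<open>k\<close> within the induction on \<open>m\<close>.\<close>

lemma card_sparse_seqs:
  assumes "\<And>j. D j \<le> 1"
  shows "card (sparse_seqs D m k) = (m + k - (\<Sum>j<m. D j)) choose m"
proof (induction m arbitrary: k)
  case 0
  have "sparse_seqs D 0 k = {\<lambda>_. 0}" by (auto simp: sparse_seqs_def fun_eq_iff) (metis neq0_conv)
  then show ?case by simp
next
  case (Suc m)
  have d: "(\<Sum>j<m. D j) \<le> m"
    using sum_bounded_above[of "{..<m}" D 1] assms by simp
  have Dm: "D m = 0 \<or> D m = 1" using assms[of m] by linarith
  note IH = Suc.IH
  show ?case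
  proof (induction k)
    case 0
    show ?case
    proof (cases "D m = 0")
      case True
      have "sparse_seqs D (Suc m) 0 = {s \<in> sparse_seqs D (Suc m) 0. s (Suc m) = 0}"
        by (auto simp: sparse_seqs_def)
      then have "card (sparse_seqs D (Suc m) 0) = card (sparse_seqs D m 0)"
        using card_sparse_seqs_last[of D m 0] True by simp
      also have "\<dots> = (m - (\<Sum>j<m. D j)) choose m" using IH[of 0] by simp
      \<comment> \<open>Both binomials are 1 if no step is strict, and 0 otherwise.\<close>
      also have "\<dots> = (Suc m - (\<Sum>j<m. D j)) choose Suc m"
      proof (cases "(\<Sum>j<m. D j) = 0")
        case False
        then have "Suc m - (\<Sum>j<m. D j) < Suc m" "m - (\<Sum>j<m. D j) < m"
          using d by linarith+
        then show ?thesis by (simp only: binomial_eq_0)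
      qed (simp only: diff_zero binomial_n_n)
      finally show ?thesis using True by simp
    next
      case False
      then have "sparse_seqs D (Suc m) 0 = {}" by (auto simp: sparse_seqs_def)
      then show ?thesis using False Dm by (simp add: binomial_eq_0)
    qed
  next
    case (Suc k)
    \<comment> \<open>The natural subtractions are exact, as the sum over \<open>j < m\<close> is at
      most \<open>m\<close> and \<open>D m\<close> at most 1. The recursion thus has the shape of
      Pascal's rule.\<close>
    have "Suc (Suc m + k - (\<Sum>j<Suc m. D j)) = Suc m + Suc k - (\<Sum>j<Suc m. D j)"
      "m + (Suc k - D m) - (\<Sum>j<m. D j) = Suc m + k - (\<Sum>j<Suc m. D j)"
      using d Dm by auto
    then show ?case
      using card_sparse_seqs_Suc_Suc[of D m k] assms IH Suc
      by (metis add.commute binomial_Suc_Suc)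
  qed
qed

section \<open>Sorted maps as sparse sequences\<close>

definition sorted_along :: "nat \<Rightarrow> (int \<Rightarrow> int) \<Rightarrow> (int \<Rightarrow> int) \<Rightarrow> bool" where
  "sorted_along n \<pi> h \<longleftrightarrow>
     (\<forall>i\<in>{0..int n - 1}. h i < h (i + 1) \<or> h i = h (i + 1) \<and> \<pi> i < \<pi> (i + 1))"

text \<open>By transitivity of \<open>prec\<close>, adjacent positions suffice. By oddness, a step
  from a negative \<open>i\<close> to \<open>i + 1\<close> mirrors the one from
  \<open>- i - 1\<close> to \<open>- i\<close>, so nonnegative positions suffice.\<close>

lemma sorts_iff_sorted_along:
  assumes "\<pi> \<in> hyperoctahedral n" "f \<in> odd_maps n x"
  shows "sorts n f \<pi> \<longleftrightarrow> sorted_along n \<pi> (f \<circ> \<pi>)"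
proof
  assume "sorts n f \<pi>"
  then show "sorted_along n \<pi> (f \<circ> \<pi>)"
    by (auto simp: sorts_def sorted_along_def prec_def)
next
  assume s: "sorted_along n \<pi> (f \<circ> \<pi>)"
  have o: "\<pi> (- i) = - \<pi> i" "f (- i) = - f i" for i
    using assms(1) odd_mapsD(1)[OF assms(2)] by (simp_all add: hyperoctahedral_def)
  have nonneg: "prec f (\<pi> i) (\<pi> (i + 1))" if "i \<in> {0..int n - 1}" for i
    using s that by (auto simp: sorted_along_def prec_def)
  have adj: "prec f (\<pi> i) (\<pi> (i + 1))" if "i \<in> {- int n..int n - 1}" for i
  proof (cases "0 \<le> i")
    case False
    then have "prec f (\<pi> (- i - 1)) (\<pi> (- i - 1 + 1))"
      using that by (intro nonneg) auto
    moreover have "\<pi> (- i - 1) = - \<pi> (i + 1)" using o(1)[of "i + 1"] by simp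
    ultimately show ?thesis by (auto simp: prec_def o)
  qed (use that nonneg in auto)
  have "j \<in> {- int n..int n} \<longrightarrow> prec f (\<pi> i) (\<pi> j)" if "i < j" "i \<in> {- int n..int n}" for i j
    using that(1)
  proof (induction rule: int_gr_induct)
    case base
    then show ?case using adj[of i] that(2) by auto
  next
    case (step j)
    then show ?case using adj[of j] that(2) by (auto simp: prec_def)
  qed
  then show "sorts n f \<pi>" using assms(1) by (auto simp: sorts_def hyperoctahedral_def)
qed

lemma card_sorting_eq:
  assumes "\<pi> \<in> hyperoctahedral n"
  shows "card {f \<in> odd_maps n x. sorting n f = \<pi>} = card {h \<in> odd_maps n x. sorted_along n \<pi> h}"
proof -
  have "{h \<in> odd_maps n x. sorted_along n \<pi> h} = {h \<in> (\<lambda>f. f \<circ> \<pi>) ` odd_maps n x. sorted_along n \<pi> h}"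
    using bij_betw_imp_surj_on[OF bij_betw_odd_maps_comp[OF assms, of x]] by simp
  also have "\<dots> = (\<lambda>f. f \<circ> \<pi>) ` {f \<in> odd_maps n x. sorting n f = \<pi>}"
    using sorts_iff_sorted_along[OF assms, of _ x] by (auto simp: sorting_eq_iff)
  finally have "{h \<in> odd_maps n x. sorted_along n \<pi> h}
      = (\<lambda>f. f \<circ> \<pi>) ` {f \<in> odd_maps n x. sorting n f = \<pi>}" .
  moreover have "inj_on (\<lambda>f. f \<circ> \<pi>) {f \<in> odd_maps n x. sorting n f = \<pi>}"
    using bij_betw_imp_inj_on[OF bij_betw_odd_maps_comp[OF assms, of x]] by (rule inj_on_subset) auto
  ultimately show ?thesis by (simp add: card_image)
qed

text \<open>The parameter \<open>e\<close> treats both parities of the number \<open>2 k + 1 - e\<close> of values at once: a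
  sorted map takes the value \<open>2 s - e\<close> with \<open>s \<le> k\<close> at a positive argument, and for \<open>e = 1\<close> the
  value \<open>0\<close> at the argument \<open>0\<close> is forced to be followed by a strict increase.\<close>

lemma card_sorted_along:
  fixes e k n :: nat
  assumes \<pi>: "\<pi> \<in> hyperoctahedral n" and e: "e = 0 \<or> e = 1"
  defines "D \<equiv> \<lambda>j. if e = 1 \<and> j = 0 \<or> \<pi> (int j) > \<pi> (int j + 1) then 1 else 0 :: nat"
  shows "card {h \<in> odd_maps n (2 * k + 1 - e). sorted_along n \<pi> h}
    = (n + k - (\<Sum>j<n. D j)) choose n"
proof -
  define x where "x = 2 * k + 1 - e"
  let ?A = "{h \<in> odd_maps n x. sorted_along n \<pi> h}"
  \<comment> \<open>\<open>T\<close> solves \<open>h j = 2 s - e\<close> for \<open>s\<close> at the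
    arguments \<open>1..n\<close>, and \<open>U\<close> is the inverse, extended as an odd map.
    Index 0 is exceptional: \<open>s 0 = 0\<close> stands for \<open>h 0 = 0\<close>, not for
    \<open>- e\<close>.\<close>
  define T where "T h j = (if 1 \<le> j \<and> j \<le> n then nat ((h (int j) + int e) div 2) else 0)"
    for h :: "int \<Rightarrow> int" and j
  define U where "U s i = (if \<bar>i\<bar> \<le> int n then sgn i * (2 * int (s (nat \<bar>i\<bar>)) - int e) else 0)"
    for s :: "nat \<Rightarrow> nat" and i
  have p: "\<pi> permutes {- int n..int n}" using \<pi> by (simp add: hyperoctahedral_def)
  have neq: "\<pi> i \<noteq> \<pi> (i + 1)" for i
    using injD[OF permutes_inj[OF p], of i "i + 1"] by auto
  have grid_iff: "v \<in> grid x \<longleftrightarrow> \<bar>v\<bar> \<le> 2 * int k - int e \<and> even (v + int e)" for v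
    using e by (auto simp: grid_def x_def)
  have T: "h (int j) = (if j = 0 then 0 else 2 * int (T h j) - int e)"
    if "h \<in> ?A" "j \<le> n" for h j
  proof (cases "j = 0")
    case True
    then show ?thesis using odd_mapsD(3)[of h n x 0] that(1) by simp
  next
    case False
    \<comment> \<open>A sorted map increases weakly from \<open>h 0 = 0\<close>, so
      \<open>nat\<close> in \<open>T\<close> loses nothing.\<close>
    have "j \<le> n \<longrightarrow> 0 \<le> h (int j)" for j
    proof (induction j)
      case 0
      then show ?case using odd_mapsD(3)[of h n x 0] that(1) by simp
    next
      case (Suc j)
      show ?case
      proof
        assume j: "Suc j \<le> n"
        then have "h (int j) \<le> h (int j + 1)"
          using that(1) by (auto simp: sorted_along_def dest!: bspec[of _ _ "int j"])
        then show "0 \<le> h (int (Suc j))" using Suc j by (simp add: add.commute)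
      qed
    qed
    then have "0 \<le> h (int j)" using that(2) by blast
    moreover have "h (int j) \<in> grid x"
      using that False by (intro odd_mapsD(2)) auto
    then have "even (h (int j) + int e)" unfolding grid_iff by blast
    ultimately show ?thesis using False that(2) by (auto simp: T_def)
  qed
  \<comment> \<open>A tie is allowed exactly where \<open>\<pi>\<close> has no descent. At
    \<open>j = 0\<close> with \<open>e = 1\<close> the next value is odd, so a tie with 0 cannot
    occur and the step is strict, in accordance with \<open>D 0 = 1\<close>.\<close>
  have step_iff: "(h i < h (i + 1) \<or> h i = h (i + 1) \<and> \<pi> i < \<pi> (i + 1)) \<longleftrightarrow> s j + D j \<le> s (Suc j)"
    if "i = int j" "h i = (if j = 0 then 0 else 2 * int (s j) - int e)"
      "h (i + 1) = 2 * int (s (Suc j)) - int e" "s 0 = 0" for h s i j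
    using that e neq[of i] by (cases "j = 0") (auto simp: D_def)
  have "bij_betw T ?A (sparse_seqs D n k)"
  proof (rule bij_betw_byWitness[where f' = U])
    show "\<forall>h\<in>?A. U (T h) = h"
    proof (intro ballI ext)
      fix h i assume h: "h \<in> ?A"
      then have ho: "h (- i) = - h i" for i using odd_mapsD(1)[of h n x i] by simp
      show "U (T h) i = h i"
      proof (cases "\<bar>i\<bar> \<le> int n")
        case True
        then show ?thesis
          using T[OF h, of "nat \<bar>i\<bar>"] ho[of "- i"] by (cases i "0 :: int" rule: linorder_cases) (auto simp: U_def)
      next
        case False
        then have "h i = 0" using h by (intro odd_mapsD(3)[of h n x]) auto
        then show ?thesis using False by (simp add: U_def)
      qed
    qed
    show "\<forall>s\<in>sparse_seqs D n k. T (U s) = s"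
      by (auto simp: T_def U_def sparse_seqs_def fun_eq_iff not_le Suc_le_eq)
    show "T ` ?A \<subseteq> sparse_seqs D n k"
    proof safe
      fix h assume h: "h \<in> odd_maps n x" "sorted_along n \<pi> h"
      then have hA: "h \<in> ?A" by simp
      have "T h j + D j \<le> T h (Suc j)" if "j < n" for j
      proof (subst step_iff[symmetric, of "int j" j h])
        show "h (int j) < h (int j + 1) \<or> h (int j) = h (int j + 1) \<and> \<pi> (int j) < \<pi> (int j + 1)"
          using h(2) that by (auto simp: sorted_along_def dest!: bspec[of _ _ "int j"])
      qed (use T[OF hA, of j] T[OF hA, of "Suc j"] that in \<open>auto simp: T_def add.commute\<close>)
      moreover have "T h n \<le> k"
      proof (cases "n = 0")
        case False
        then have "h (int n) \<in> grid x" by (intro odd_mapsD(2)[OF h(1)]) auto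
        then show ?thesis using T[OF hA, of n] False by (simp add: grid_iff)
      qed (simp add: T_def)
      ultimately show "T h \<in> sparse_seqs D n k" by (simp add: sparse_seqs_def T_def)
    qed
    show "U ` sparse_seqs D n k \<subseteq> ?A"
    proof safe
      fix s assume s: "s \<in> sparse_seqs D n k"
      have s_le: "s j \<le> k" if "j \<le> n" for j
        using sparse_seqs_mono[OF s that] s by (simp add: sparse_seqs_def)
      \<comment> \<open>For \<open>e = 1\<close> the strict first step forces
        \<open>s j \<ge> 1\<close>, so \<open>2 s - e\<close> is nonnegative and bounded in absolute
        value by \<open>2 k - e\<close>.\<close>
      have s_ge: "e \<le> s j" if "1 \<le> j" "j \<le> n" for j
      proof -
        have "0 < n" using that by simp
        then have "s 0 + D 0 \<le> s (Suc 0)" using s unfolding sparse_seqs_def by blast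
        moreover have "s (Suc 0) \<le> s j" using sparse_seqs_mono[OF s, of "Suc 0" j] that by simp
        ultimately show ?thesis using e by (auto simp: D_def)
      qed
      show "U s \<in> odd_maps n x"
      proof (rule odd_mapsI)
        show "U s (- i) = - U s i" for i by (simp add: U_def)
        show "U s i = 0" if "i \<notin> {- int n..int n} - {0}" for i
          using that by (auto simp: U_def)
        show "U s i \<in> grid x" if "i \<in> {- int n..int n} - {0}" for i
        proof -
          have "e \<le> s (nat \<bar>i\<bar>)" "s (nat \<bar>i\<bar>) \<le> k" using that by (auto intro!: s_ge s_le)
          then show ?thesis using that e by (auto simp: U_def grid_iff sgn_if)
        qed
      qed
      show "sorted_along n \<pi> (U s)"
        unfolding sorted_along_def
      proof
        fix i assume i: "i \<in> {0..int n - 1}"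
        show "U s i < U s (i + 1) \<or> U s i = U s (i + 1) \<and> \<pi> i < \<pi> (i + 1)"
        proof (subst step_iff[of i "nat i" _ s])
          show "s (nat i) + D (nat i) \<le> s (Suc (nat i))" "s 0 = 0"
            using s i by (auto simp: sparse_seqs_def)
          show "U s (i + 1) = 2 * int (s (Suc (nat i))) - int e"
            using i by (auto simp: U_def Suc_nat_eq_nat_zadd1 add.commute)
        qed (use i in \<open>auto simp: U_def\<close>)
      qed
    qed
  qed
  then have "card ?A = card (sparse_seqs D n k)" by (rule bij_betw_same_card)
  also have "\<dots> = (n + k - (\<Sum>j<n. D j)) choose n"
    by (rule card_sparse_seqs) (simp add: D_def)
  finally show ?thesis by (simp add: x_def)
qed

lemma card_int_interval_eq_sum:
  "card {i \<in> {0..int n - 1}. P i} = (\<Sum>j<n. if P (int j) then 1 else 0)"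
proof -
  have "card {j \<in> {..<n}. P (int j)} = card {i \<in> {0..int n - 1}. P i}"
    by (rule bij_betw_same_card[of int], rule bij_betw_byWitness[where f' = nat]) auto
  then show ?thesis by (simp add: sum.If_cases Int_def)
qed

lemma lookup_shuffle_sum:
  "Poly_Mapping.lookup (shuffle_sum n x) \<pi> = (if \<pi> \<in> hyperoctahedral n
     then of_nat (card {h \<in> odd_maps n x. sorted_along n \<pi> h}) else 0)"
proof -
  have "Poly_Mapping.lookup (shuffle_sum n x) \<pi> = of_nat (card {f \<in> odd_maps n x. sorting n f = \<pi>})"
    by (simp add: shuffle_sum_def lookup_sum lookup_single when_def sum.If_cases finite_odd_maps
        Int_def)
  moreover have "{f \<in> odd_maps n x. sorting n f = \<pi>} = {}" if "\<pi> \<notin> hyperoctahedral n"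
    using sorting_in_hyperoctahedral odd_mapsD(1) that by blast
  ultimately show ?thesis by (cases "\<pi> \<in> hyperoctahedral n") (simp_all add: card_sorting_eq)
qed

text \<open>With \<open>e = 1\<close> position 0 always counts as a strict step, whatever the sign
  of \<open>\<pi> 1\<close>; the remaining strict steps are the descents of type A.\<close>

lemma shuffle_sum_even:
  assumes "n \<ge> 1"
  shows "shuffle_sum n (2 * k) = galg_eval n (coeff (gen_A n)) (of_nat (2 * k))"
proof (rule poly_mapping_eqI)
  fix \<pi>
  have "(\<Sum>j<n. if j = 0 \<or> \<pi> (int j + 1) < \<pi> (int j) then 1 else 0) = 1 + des_A n \<pi>"
  proof -
    have "{i \<in> {0..int n - 1}. i = 0 \<or> \<pi> (i + 1) < \<pi> i}
        = insert 0 {i \<in> {1..int n - 1}. \<pi> (i + 1) < \<pi> i}"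
      using assms by auto
    moreover have "finite {i \<in> {1..int n - 1}. \<pi> (i + 1) < \<pi> i}"
      by (rule finite_subset[of _ "{1..int n - 1}"]) auto
    ultimately have "card {i \<in> {0..int n - 1}. i = 0 \<or> \<pi> (i + 1) < \<pi> i} = 1 + des_A n \<pi>"
      unfolding des_A_def by (simp only: card_insert_disjoint) simp
    then show ?thesis by (subst (asm) card_int_interval_eq_sum) simp
  qed
  then show "Poly_Mapping.lookup (shuffle_sum n (2 * k)) \<pi>
      = Poly_Mapping.lookup (galg_eval n (coeff (gen_A n)) (of_nat (2 * k))) \<pi>"
    using card_sorted_along[of \<pi> n 1 k]
    by (simp only: lookup_shuffle_sum lookup_eval_gen_A[OF assms]) (simp split: if_splits)
qed

text \<open>With \<open>e = 0\<close> position 0 is treated like the others, so the strict steps are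
  the descents of type B.\<close>

lemma shuffle_sum_odd:
  "shuffle_sum n (2 * k + 1) = galg_eval n (coeff (gen_B n)) (of_nat (2 * k + 1))"
proof (rule poly_mapping_eqI)
  fix \<pi>
  have "(\<Sum>j<n. if \<pi> (int j + 1) < \<pi> (int j) then 1 else 0) = des_B n \<pi>"
    unfolding des_B_def by (rule card_int_interval_eq_sum[symmetric])
  then show "Poly_Mapping.lookup (shuffle_sum n (2 * k + 1)) \<pi>
      = Poly_Mapping.lookup (galg_eval n (coeff (gen_B n)) (of_nat (2 * k + 1))) \<pi>"
    using card_sorted_along[of \<pi> n 0 k]
    by (simp only: lookup_shuffle_sum lookup_eval_gen_B) simp
qed

subsection \<open>The flag descent sums\<close>

lemma des_B_eq_des_A:
  assumes "n \<ge> 1" "\<pi> \<in> hyperoctahedral n"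
  shows "des_B n \<pi> = des_A n \<pi> + (if \<pi> 1 < 0 then 1 else 0)"
proof -
  let ?S = "{i \<in> {1..int n - 1}. \<pi> i > \<pi> (i + 1)}"
  have fin: "finite ?S" by (rule finite_subset[of _ "{1..int n - 1}"]) auto
  have eq: "{i \<in> {0..int n - 1}. \<pi> i > \<pi> (i + 1)} = (if \<pi> 1 < 0 then insert 0 ?S else ?S)"
  proof -
    have "{0..int n - 1} = insert 0 {1..int n - 1}" using assms(1) by auto
    then show ?thesis using hyperoctahedral_0[OF assms(2)] by auto
  qed
  show ?thesis
    unfolding des_A_def des_B_def eq using card_insert_disjoint[OF fin, of 0] by simp
qed

text \<open>The flag descent number is twice \<open>des_A\<close>, plus 1 if
  \<open>\<pi> 1 < 0\<close>. So it determines both descent numbers, and with them the coefficients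
  of both generating functions.\<close>

lemma des_of_fdes:
  assumes "n \<ge> 1" "\<pi> \<in> hyperoctahedral n"
  shows "des_A n \<pi> = fdes n \<pi> div 2" "des_B n \<pi> = (fdes n \<pi> + 1) div 2"
  using des_B_eq_des_A[OF assms] by (auto simp: fdes_def)

lemma fdes_less:
  assumes "n \<ge> 1"
  shows "fdes n \<pi> < 2 * n"
  using des_A_le[of n \<pi>] des_B_le[of n \<pi>] assms by (simp add: fdes_def)

lemma lookup_flag_sum:
  "Poly_Mapping.lookup (flag_sum n i) \<pi> = (if \<pi> \<in> hyperoctahedral n \<and> fdes n \<pi> = i then 1 else 0)"
proof -
  have "finite {\<pi> \<in> hyperoctahedral n. fdes n \<pi> = i}"
    by (rule finite_subset[OF _ finite_hyperoctahedral[of n]]) auto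
  then show ?thesis by (simp add: flag_sum_def lookup_sum lookup_single when_def)
qed

lemma eq_sum_flag_sum:
  assumes "n \<ge> 1"
    and "\<And>\<pi>. Poly_Mapping.lookup u \<pi> = (if \<pi> \<in> hyperoctahedral n then c (fdes n \<pi>) else 0)"
  shows "u = (\<Sum>i<2 * n. gscale (c i) (flag_sum n i))"
proof (rule poly_mapping_eqI)
  fix \<pi>
  have "(\<Sum>i<2 * n. c i * (if \<pi> \<in> hyperoctahedral n \<and> fdes n \<pi> = i then 1 else 0))
      = (\<Sum>i<2 * n. if fdes n \<pi> = i then (if \<pi> \<in> hyperoctahedral n then c i else 0) else 0)"
    by (rule sum.cong) auto
  then show "Poly_Mapping.lookup u \<pi>
      = Poly_Mapping.lookup (\<Sum>i<2 * n. gscale (c i) (flag_sum n i)) \<pi>"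
    using fdes_less[OF assms(1), of \<pi>] by (simp add: assms(2) lookup_sum lookup_flag_sum)
qed

lemma flag_descent_algebra_eq:
  assumes "n \<ge> 1"
  shows "flag_descent_algebra n = galg.span (flag_sum n ` {..<2 * n})"
proof -
  have "{0..2 * n - 1} = {..<2 * n}" using assms by auto
  then show ?thesis by (simp add: flag_descent_algebra_def)
qed

lemma sum_flag_sum_in_span: "(\<Sum>i<2 * n. gscale (c i) (flag_sum n i)) \<in> galg.span (flag_sum n ` {..<2 * n})"
  by (intro galg.span_sum galg.span_scale galg.span_base) auto

text \<open>Changing the sign on \<open>{l..k+1}\<close>, with \<open>l = 1\<close> or \<open>l = 2\<close>, creates exactly \<open>k\<close> descents of
  type A.\<close>

lemma exists_fdes:
  assumes "i < 2 * n"
  shows "\<exists>\<pi>\<in>hyperoctahedral n. fdes n \<pi> = i"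
proof -
  define k where "k = i div 2"
  \<comment> \<open>Including 1 in the block makes \<open>\<pi> 1\<close> negative, which adds the
    descent at 0 needed for odd \<open>i\<close>.\<close>
  define l :: int where "l = (if odd i then 1 else 2)"
  define \<pi> where "\<pi> j = (if l \<le> \<bar>j\<bar> \<and> \<bar>j\<bar> \<le> int k + 1 then - j else j)" for j
  have n: "n \<ge> 1" and k: "int k + 1 \<le> int n" using assms by (auto simp: k_def)
  have l: "l = 1 \<or> l = 2" by (simp add: l_def)
  have "bij_betw \<pi> {- int n..int n} {- int n..int n}"
    by (rule bij_betw_byWitness[where f' = \<pi>]) (use k in \<open>auto simp: \<pi>_def split: if_splits\<close>)
  then have "\<pi> permutes {- int n..int n}"
    by (rule bij_imp_permutes) (use k in \<open>auto simp: \<pi>_def\<close>)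
  then have h: "\<pi> \<in> hyperoctahedral n" by (simp add: hyperoctahedral_def \<pi>_def)
  have "{j \<in> {1..int n - 1}. \<pi> j > \<pi> (j + 1)} = {1..int k}"
    using k l by (auto simp: \<pi>_def)
  then have A: "des_A n \<pi> = k" by (simp add: des_A_def)
  have "\<pi> 1 < 0 \<longleftrightarrow> odd i" by (auto simp: \<pi>_def l_def)
  then have "fdes n \<pi> = i"
    using des_B_eq_des_A[OF n h] A by (auto simp: fdes_def k_def elim!: oddE evenE)
  then show ?thesis using h by blast
qed

lemma inj_on_flag_sum: "inj_on (flag_sum n) {..<2 * n}"
proof (rule inj_onI)
  fix i j assume "i \<in> {..<2 * n}" and eq: "flag_sum n i = flag_sum n j"
  then obtain \<pi> where "\<pi> \<in> hyperoctahedral n" "fdes n \<pi> = i" using exists_fdes by blast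
  then have "Poly_Mapping.lookup (flag_sum n j) \<pi> = 1"
    by (simp add: eq[symmetric] lookup_flag_sum)
  then show "i = j"
    using \<open>fdes n \<pi> = i\<close> by (simp add: lookup_flag_sum split: if_splits)
qed

text \<open>The supports are disjoint, and nonempty by \<open>exists_fdes\<close>; the coefficient
  at one permutation of each support isolates one scalar.\<close>

lemma independent_flag_sum: "galg.independent (flag_sum n ` {..<2 * n})"
proof (rule galg.independent_if_scalars_zero)
  fix c u assume 0: "(\<Sum>u\<in>flag_sum n ` {..<2 * n}. gscale (c u) u) = 0"
    and "u \<in> flag_sum n ` {..<2 * n}"
  then obtain i where i: "i < 2 * n" "u = flag_sum n i" by auto
  then obtain \<pi> where \<pi>: "\<pi> \<in> hyperoctahedral n" "fdes n \<pi> = i" using exists_fdes by blast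
  have "0 = Poly_Mapping.lookup (\<Sum>i<2 * n. gscale (c (flag_sum n i)) (flag_sum n i)) \<pi>"
    using 0 by (simp add: sum.reindex[OF inj_on_flag_sum])
  also have "\<dots> = (\<Sum>j<2 * n. if i = j then c (flag_sum n j) else 0)"
    unfolding lookup_sum lookup_gscale lookup_flag_sum using \<pi> by (intro sum.cong) auto
  also have "\<dots> = c u" using i by simp
  finally show "c u = 0" by simp
qed simp

text \<open>Inversion of a unitriangular system: solve for the last flag sum and use induction for
  the earlier ones.\<close>

lemma flag_sum_in_subspace:
  assumes "galg.subspace V" "i < 2 * n"
    and V: "\<And>j. j < 2 * n \<Longrightarrow> \<exists>c. (\<Sum>m<2 * n. gscale (c m) (flag_sum n m)) \<in> V \<and>
      c j = 1 \<and> (\<forall>m>j. c m = 0)"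
  shows "flag_sum n i \<in> V"
  using assms(2)
proof (induction i rule: less_induct)
  case (less i)
  obtain c where c: "(\<Sum>m<2 * n. gscale (c m) (flag_sum n m)) \<in> V" "c i = 1" "\<And>m. m > i \<Longrightarrow> c m = 0"
    using V[OF less.prems] by blast
  have "(\<Sum>m<2 * n. gscale (c m) (flag_sum n m)) = (\<Sum>m\<le>i. gscale (c m) (flag_sum n m))"
    by (rule sum.mono_neutral_right) (use less.prems c(3) in auto)
  also have "\<dots> = (\<Sum>m<i. gscale (c m) (flag_sum n m)) + flag_sum n i"
    by (simp add: lessThan_Suc_atMost[symmetric] c(2))
  finally have "flag_sum n i = (\<Sum>m<2 * n. gscale (c m) (flag_sum n m))
      - (\<Sum>m<i. gscale (c m) (flag_sum n m))" by simp
  moreover have "(\<Sum>m<i. gscale (c m) (flag_sum n m)) \<in> V"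
    using less by (intro galg.subspace_sum[OF assms(1)] galg.subspace_scale[OF assms(1)]) auto
  ultimately show ?case using galg.subspace_diff[OF assms(1) c(1)] by simp
qed

subsection \<open>The idempotents\<close>

text \<open>The leading coefficient does not depend on \<open>c\<close>, hence not on descents.
  Therefore the top coefficients of \<open>gen_A n\<close> and \<open>gen_B n\<close> coincide,
  which gives \<open>flag_idem_last\<close>.\<close>

lemma coeff_poly_binom_degree:
  assumes "d \<noteq> 0"
  shows "coeff (poly_binom [:c, d:] n) n = d ^ n / fact n"
proof -
  have "(\<Prod>k<n. [:c, d:] - of_nat k) = (\<Prod>k<n. [:c - of_nat k, d:])"
    by (simp add: of_nat_poly)
  moreover have "degree (\<Prod>k<n. [:c - of_nat k, d:]) = n"
    using assms by (subst degree_prod_eq_sum_degree) auto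
  moreover have "lead_coeff (\<Prod>k<n. [:c - of_nat k, d:]) = d ^ n"
    using assms by (subst lead_coeff_prod) auto
  ultimately show ?thesis by (simp add: poly_binom_def)
qed

lemma a_coeff_eq: "n \<ge> 1 \<Longrightarrow> a_coeff n i = coeff (gen_A n) i"
  by (simp add: a_coeff_def coeff_gen_A_0)

lemma flag_idem_last:
  assumes "n \<ge> 1"
  shows "flag_idem n (2 * n + 1) = 0"
proof -
  have "coeff (gen_B n) n = coeff (gen_A n) n"
    by (rule poly_mapping_eqI) (simp add: lookup_coeff_gen_A lookup_coeff_gen_B coeff_poly_binom_degree)
  then show ?thesis using assms by (simp add: flag_idem_def a_coeff_eq b_coeff_def)
qed

text \<open>A product of two numbers is odd only if both are, so \<open>gen_A\<close> absorbs
  \<open>gen_B\<close> from either side. The even numbers \<open>X\<close> and the odd numbers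
  \<open>Y\<close> are infinite sets of evaluation points.\<close>

lemma coeff_gen_products:
  assumes n: "n \<ge> 1" and "i \<le> n" "j \<le> n"
  shows "coeff (gen_A n) i \<star> coeff (gen_A n) j = (if i = j then coeff (gen_A n) i else 0)"
    and "coeff (gen_A n) i \<star> coeff (gen_B n) j = (if i = j then coeff (gen_A n) i else 0)"
    and "coeff (gen_B n) i \<star> coeff (gen_A n) j = (if i = j then coeff (gen_A n) i else 0)"
    and "coeff (gen_B n) i \<star> coeff (gen_B n) j = (if i = j then coeff (gen_B n) i else 0)"
proof -
  define X Y where "X = range (\<lambda>k. of_nat (2 * k) :: rat)"
    and "Y = range (\<lambda>k. of_nat (2 * k + 1) :: rat)"
  have inf: "infinite X" "infinite Y"
    unfolding X_def Y_def by (intro range_inj_infinite injI; simp)+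
  have A: "\<exists>m. even m \<and> x = of_nat m \<and> galg_eval n (coeff (gen_A n)) x = shuffle_sum n m"
    if x: "x \<in> X" for x
  proof -
    obtain k where "x = of_nat (2 * k)" using x unfolding X_def by blast
    then show ?thesis using shuffle_sum_even[OF n, of k] by (intro exI[of _ "2 * k"]) simp
  qed
  have B: "\<exists>m. odd m \<and> x = of_nat m \<and> galg_eval n (coeff (gen_B n)) x = shuffle_sum n m"
    if x: "x \<in> Y" for x
  proof -
    obtain k where "x = of_nat (2 * k + 1)" using x unfolding Y_def by blast
    then show ?thesis using shuffle_sum_odd[of n k] by (intro exI[of _ "2 * k + 1"]) simp
  qed
  have A': "galg_eval n (coeff (gen_A n)) (of_nat m * of_nat m') = shuffle_sum n (m * m')"
    if "even (m * m')" for m m'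
    using that shuffle_sum_even[OF n, of "m * m' div 2"]
    by (simp only: dvd_mult_div_cancel of_nat_mult[symmetric])
  have B': "galg_eval n (coeff (gen_B n)) (of_nat m * of_nat m') = shuffle_sum n (m * m')"
    if "odd (m * m')" for m m'
    using shuffle_sum_odd[of n "m * m' div 2"]
    unfolding odd_two_times_div_two_succ[OF that] of_nat_mult by (rule sym)
  show "coeff (gen_A n) i \<star> coeff (gen_A n) j = (if i = j then coeff (gen_A n) i else 0)"
    by (rule coeff_gmult_of_eval_gmult[OF inf(1,1) _ assms(2,3)])
      (auto dest!: A simp: A' shuffle_sum_mult)
  show "coeff (gen_A n) i \<star> coeff (gen_B n) j = (if i = j then coeff (gen_A n) i else 0)"
    by (rule coeff_gmult_of_eval_gmult[OF inf(1,2) _ assms(2,3)])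
      (auto dest!: A B simp: A' shuffle_sum_mult)
  show "coeff (gen_B n) i \<star> coeff (gen_A n) j = (if i = j then coeff (gen_A n) i else 0)"
    by (rule coeff_gmult_of_eval_gmult[OF inf(2,1) _ assms(2,3)])
      (auto dest!: A B simp: A' shuffle_sum_mult)
  show "coeff (gen_B n) i \<star> coeff (gen_B n) j = (if i = j then coeff (gen_B n) i else 0)"
    by (rule coeff_gmult_of_eval_gmult[OF inf(2,2) _ assms(2,3)])
      (auto dest!: B simp: B' shuffle_sum_mult)
qed

text \<open>Different halves of the indices give 0. For equal halves,
  \<open>a a = a b = b a = a\<close> and \<open>b b = b\<close> yield
  \<open>(b - a)(b - a) = b - a\<close> and \<open>a (b - a) = (b - a) a = 0\<close>.\<close>

lemma flag_idem_mult:
  assumes "n \<ge> 1" "i \<in> {1..2 * n}" "j \<in> {1..2 * n}"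
  shows "flag_idem n i \<star> flag_idem n j = (if i = j then flag_idem n i else 0)"
proof -
  have le: "i div 2 \<le> n" "j div 2 \<le> n" using assms by auto
  have eq: "i = j \<longleftrightarrow> i div 2 = j div 2 \<and> (even i \<longleftrightarrow> even j)"
    by (metis even_two_times_div_two odd_two_times_div_two_succ)
  show ?thesis
    unfolding flag_idem_def a_coeff_eq[OF assms(1)] b_coeff_def
    by (auto simp: eq gmult_diff_left gmult_diff_right coeff_gen_products[OF assms(1) le]
        coeff_gen_products[OF assms(1) le(2,2)])
qed

section \<open>Change of generators between flag descent sums and idempotents\<close>

lemma coeff_gen_in_span_flag_sum:
  assumes "n \<ge> 1"
  shows "coeff (gen_A n) i \<in> galg.span (flag_sum n ` {..<2 * n})"
    and "coeff (gen_B n) i \<in> galg.span (flag_sum n ` {..<2 * n})"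
proof -
  have "coeff (gen_A n) i = (\<Sum>m<2 * n. gscale
      (coeff (poly_binom [:of_nat n - 1 - of_nat (m div 2), 1/2:] n) i) (flag_sum n m))"
    by (rule eq_sum_flag_sum[OF assms]) (auto simp: lookup_coeff_gen_A des_of_fdes[OF assms])
  then show "coeff (gen_A n) i \<in> galg.span (flag_sum n ` {..<2 * n})"
    by (simp only: sum_flag_sum_in_span)
  have "coeff (gen_B n) i = (\<Sum>m<2 * n. gscale
      (coeff (poly_binom [:of_nat n - of_nat ((m + 1) div 2) - 1/2, 1/2:] n) i) (flag_sum n m))"
    by (rule eq_sum_flag_sum[OF assms]) (auto simp: lookup_coeff_gen_B des_of_fdes[OF assms])
  then show "coeff (gen_B n) i \<in> galg.span (flag_sum n ` {..<2 * n})"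
    by (simp only: sum_flag_sum_in_span)
qed

text \<open>The boundary indices 0 and \<open>2 n + 1\<close> fall outside
  \<open>{1..2 * n}\<close>, but the elements there are 0.\<close>

lemma coeff_gen_in_span_flag_idem:
  assumes n: "n \<ge> 1" and "i \<le> n"
  shows "coeff (gen_A n) i \<in> galg.span (flag_idem n ` {1..2 * n})"
    and "coeff (gen_B n) i \<in> galg.span (flag_idem n ` {1..2 * n})"
proof -
  have even: "coeff (gen_A n) i = flag_idem n (2 * i)"
    using n by (simp add: flag_idem_def a_coeff_eq)
  have odd: "coeff (gen_B n) i = flag_idem n (2 * i + 1) + coeff (gen_A n) i"
    using n by (simp add: flag_idem_def a_coeff_eq b_coeff_def)
  show A: "coeff (gen_A n) i \<in> galg.span (flag_idem n ` {1..2 * n})"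
  proof (cases "i = 0")
    case True
    then show ?thesis using coeff_gen_A_0[OF n] galg.span_zero by simp
  next
    case False
    then show ?thesis unfolding even using assms(2) by (intro galg.span_base imageI) auto
  qed
  have "flag_idem n (2 * i + 1) \<in> galg.span (flag_idem n ` {1..2 * n})"
  proof (cases "i = n")
    case True
    then show ?thesis using flag_idem_last[OF n] galg.span_zero by simp
  next
    case False
    then show ?thesis using assms(2) by (intro galg.span_base imageI) auto
  qed
  then show "coeff (gen_B n) i \<in> galg.span (flag_idem n ` {1..2 * n})"
    unfolding odd using A by (rule galg.span_add)
qed

text \<open>The generating function matching the parity of \<open>j + 1\<close>, taken at
  \<open>j + 1\<close>, lies in the span and is \<open>flag_sum n j\<close> plus earlier flag
  sums.\<close>

lemma flag_sum_in_span_flag_idem: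
  assumes n: "n \<ge> 1" and "i < 2 * n"
  shows "flag_sum n i \<in> galg.span (flag_idem n ` {1..2 * n})"
proof (rule flag_sum_in_subspace[OF galg.subspace_span assms(2)])
  fix j assume j: "j < 2 * n"
  let ?V = "galg.span (flag_idem n ` {1..2 * n})"
  have eval: "galg_eval n (coeff (gen_A n)) x \<in> ?V" "galg_eval n (coeff (gen_B n)) x \<in> ?V" for x
    unfolding galg_eval_def using coeff_gen_in_span_flag_idem[OF n]
    by (auto intro!: galg.span_sum galg.span_scale)
  show "\<exists>c. (\<Sum>m<2 * n. gscale (c m) (flag_sum n m)) \<in> ?V \<and> c j = 1 \<and> (\<forall>m>j. c m = 0)"
  proof (cases "even j")
    case True
    define k where "k = j div 2"
    have jk: "j = 2 * k" using True by (simp add: k_def)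
    \<comment> \<open>At \<open>m = 2 k\<close> the upper entry is \<open>n\<close>; for larger
      \<open>m\<close> it drops below \<open>n\<close>.\<close>
    define c :: "nat \<Rightarrow> rat" where "c m = of_nat ((n + k - (m + 1) div 2) choose n)" for m
    have "galg_eval n (coeff (gen_B n)) (of_nat (2 * k + 1))
        = (\<Sum>m<2 * n. gscale (c m) (flag_sum n m))"
      unfolding c_def by (rule eq_sum_flag_sum[OF n])
        (simp only: lookup_eval_gen_B des_of_fdes[OF n] cong: if_cong)
    moreover have "c j = 1" by (simp add: c_def jk)
    moreover have "c m = 0" if "m > j" for m
      using that n by (auto simp: c_def jk intro!: binomial_eq_0)
    ultimately show ?thesis using eval(2) by metis
  next
    case False
    then obtain q where jq: "j = 2 * q + 1" by (rule oddE)
    \<comment> \<open>Chosen so that the even argument \<open>2 * k\<close> equals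
      \<open>j + 1\<close>.\<close>
    define k where "k = q + 1"
    define c :: "nat \<Rightarrow> rat" where "c m = of_nat ((n + k - 1 - m div 2) choose n)" for m
    have "galg_eval n (coeff (gen_A n)) (of_nat (2 * k))
        = (\<Sum>m<2 * n. gscale (c m) (flag_sum n m))"
      unfolding c_def by (rule eq_sum_flag_sum[OF n])
        (simp only: lookup_eval_gen_A[OF n] des_of_fdes[OF n] cong: if_cong)
    moreover have "c j = 1" by (simp add: c_def k_def jq)
    moreover have "c m = 0" if "m > j" for m
    proof -
      have "q + 1 \<le> m div 2" using that jq by linarith
      then have "n + k - 1 - m div 2 < n" using n by (simp add: k_def)
      then show ?thesis by (simp add: c_def binomial_eq_0)
    qed
    ultimately show ?thesis using eval(1) by metis
  qed
qed

lemma span_flag_idem: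
  assumes "n \<ge> 1"
  shows "galg.span (flag_idem n ` {1..2 * n}) = flag_descent_algebra n"
  unfolding flag_descent_algebra_eq[OF assms]
proof (intro antisym galg.span_minimal galg.subspace_span)
  show "flag_idem n ` {1..2 * n} \<subseteq> galg.span (flag_sum n ` {..<2 * n})"
    using coeff_gen_in_span_flag_sum[OF assms] assms
    by (auto simp: flag_idem_def a_coeff_eq b_coeff_def intro!: galg.span_diff)
  show "flag_sum n ` {..<2 * n} \<subseteq> galg.span (flag_idem n ` {1..2 * n})"
    using flag_sum_in_span_flag_idem[OF assms] by auto
qed

section \<open>Dimension count for the basis property\<close>

lemma card_ge_of_span_flag_descent_algebra:
  assumes "n \<ge> 1" "finite S" "galg.span S = flag_descent_algebra n"
  shows "2 * n \<le> card S"
proof -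
  have "flag_sum n ` {..<2 * n} \<subseteq> galg.span S"
    using assms(3) galg.span_superset by (simp add: flag_descent_algebra_eq[OF assms(1)])
  then have "card (flag_sum n ` {..<2 * n}) \<le> card S"
    using galg.independent_span_bound[OF assms(2) independent_flag_sum] by blast
  then show ?thesis by (simp add: card_image[OF inj_on_flag_sum])
qed

text \<open>A repetition would leave fewer than \<open>2 n\<close> generators of a space containing
  \<open>2 n\<close> independent elements.\<close>

lemma inj_on_flag_idem:
  assumes "n \<ge> 1"
  shows "inj_on (flag_idem n) {1..2 * n}"
proof (rule eq_card_imp_inj_on)
  have "2 * n \<le> card (flag_idem n ` {1..2 * n})"
    by (intro card_ge_of_span_flag_descent_algebra[OF assms _ span_flag_idem[OF assms]]) simp
  moreover have "card (flag_idem n ` {1..2 * n}) \<le> 2 * n"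
    using card_image_le[of "{1..2 * n}" "flag_idem n"] by simp
  ultimately show "card (flag_idem n ` {1..2 * n}) = card {1..2 * n}"
    unfolding card_atLeastAtMost by linarith
qed simp

text \<open>Likewise, a dependent generator could be dropped, leaving a spanning set with fewer than
  \<open>2 n\<close> elements.\<close>

lemma independent_flag_idem:
  assumes "n \<ge> 1"
  shows "galg.independent (flag_idem n ` {1..2 * n})"
proof
  let ?S = "flag_idem n ` {1..2 * n}"
  assume "galg.dependent ?S"
  then obtain u where u: "u \<in> ?S" "u \<in> galg.span (?S - {u})"
    by (auto simp: galg.dependent_def)
  then have "galg.span (?S - {u}) = flag_descent_algebra n"
    using galg.span_redundant[OF u(2)] span_flag_idem[OF assms] by (simp add: insert_absorb)
  then have "2 * n \<le> card (?S - {u})"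
    using card_ge_of_span_flag_descent_algebra[OF assms] by simp
  also have "\<dots> < card ?S" using u(1) by (intro card_Diff1_less) simp_all
  also have "\<dots> = 2 * n" using card_image[OF inj_on_flag_idem[OF assms]] by simp
  finally show False by simp
qed

theorem mainTheorem4:
  fixes n :: nat
  assumes "n \<ge> 1"
  shows "flag_idem n (2 * n + 1) = 0 \<and>
    (inj_on (flag_idem n) {1..2 * n} \<and>
     galg.independent (flag_idem n ` {1..2 * n}) \<and>
     galg.span (flag_idem n ` {1..2 * n}) = flag_descent_algebra n) \<and>
    (\<forall>i\<in>{1..2 * n}. flag_idem n i \<star> flag_idem n i = flag_idem n i) \<and>
    (\<forall>i\<in>{1..2 * n}. \<forall>j\<in>{1..2 * n}. i \<noteq> j \<longrightarrow> flag_idem n i \<star> flag_idem n j = 0)"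
  using flag_idem_last[OF assms] inj_on_flag_idem[OF assms] independent_flag_idem[OF assms]
    span_flag_idem[OF assms] flag_idem_mult[OF assms] by simp

end
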